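(* Let $N\in\mathbb{N}$, $a\ge0$, $b>0$, and put $\alpha:=a+b-1$, $\beta:=b-1$. For $\kappa>0$ let $X_\kappa$ be an $\mathbb{R}^N$-valued random variable whose distribution is the probability measure on $A:=\{x\in\mathbb{R}^N:\ -1\le x_1\le\dots\le x_N\le 1\}$ with Lebesgue density $$c_\kappa\prod_{1\le i<j\le N}(x_j-x_i)^{\kappa}\prod_{i=1}^N(1-x_i)^{\frac{\kappa(a+b)}{2}-\frac12}(1+x_i)^{\frac{\kappa b}{2}-\frac12},$$ with normalizing constant $c_\kappa>0$. Let $z=(z_1,\dots,z_N)$ be the vector of ordered zeros $z_1\le\dots\le z_N$ of the Jacobi polynomial $P_N^{(\alpha,\beta)}$. Then $\sqrt{\kappa}(X_\kappa-z)$ converges in distribution, as $\kappa\to\infty$, to the centered $N$-dimensional normal distribution $N(0,\Sigma)$, where $\Sigma$ is invertible and $S=\Sigma^{-1}=(s_{i,j})_{i,j=1,\dots,N}$ is given by $$s_{j,j}=\sum_{l=1,\,l\ne j}^N\frac{1}{(z_j-z_l)^2}+\frac{a+b}{2}\frac{1}{(1-z_j)^2}+\frac{b}{2}\frac{1}{(1+z_j)^2},\qquad s_{i,j}=\frac{-1}{(z_i-z_j)^2}\ (i\ne j).$$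
   Context: For $\alpha,\beta>-1$, $P_N^{(\alpha,\beta)}$ denotes the classical Jacobi polynomial of degree $N$, orthogonal on $]-1,1[$ with respect to the weight $(1-x)^\alpha(1+x)^\beta$; its $N$ zeros are simple and lie in $]-1,1[$. *)

theory Defs
  imports "HOL-Probability.Probability" "HOL-Combinatorics.Permutations"
begin

text \<open>Vectors in R^N are modelled as extensional functions nat => real on the index
set {..<N} (index i corresponds to coordinate i+1 of the paper); R^N carries the
product Lebesgue measure.\<close>

definition RN :: "nat \<Rightarrow> (nat \<Rightarrow> real) measure" where
  "RN N = PiM {..<N} (\<lambda>_. lborel)"

definition jacobiP :: "nat \<Rightarrow> real \<Rightarrow> real \<Rightarrow> real \<Rightarrow> real" where
  "jacobiP N al be x =
     (\<Sum>k\<le>N. ((real N + al) gchoose (N - k)) * ((real N + be) gchoose k)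
              * ((x - 1) / 2) ^ k * ((x + 1) / 2) ^ (N - k))"

text \<open>Matrices are functions nat => nat => real, only entries with indices < N matter.\<close>
definition mat_det :: "nat \<Rightarrow> (nat \<Rightarrow> nat \<Rightarrow> real) \<Rightarrow> real" where
  "mat_det N M = (\<Sum>p | p permutes {..<N}. real_of_int (sign p) * (\<Prod>i<N. M i (p i)))"

definition is_inverse :: "nat \<Rightarrow> (nat \<Rightarrow> nat \<Rightarrow> real) \<Rightarrow> (nat \<Rightarrow> nat \<Rightarrow> real) \<Rightarrow> bool" where
  "is_inverse N M T \<longleftrightarrow>
     (\<forall>i<N. \<forall>j<N. (\<Sum>k<N. M i k * T k j) = (if i = j then 1 else 0)) \<and>
     (\<forall>i<N. \<forall>j<N. (\<Sum>k<N. T i k * M k j) = (if i = j then 1 else 0))"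

definition mat_inv :: "nat \<Rightarrow> (nat \<Rightarrow> nat \<Rightarrow> real) \<Rightarrow> (nat \<Rightarrow> nat \<Rightarrow> real)" where
  "mat_inv N M = (SOME T. is_inverse N M T)"

text \<open>Centered N-dimensional normal distribution N(0,Cov) (Cov invertible, positive
definite), given by its Lebesgue density.\<close>
definition centered_normal :: "nat \<Rightarrow> (nat \<Rightarrow> nat \<Rightarrow> real) \<Rightarrow> (nat \<Rightarrow> real) measure" where
  "centered_normal N Cov = density (RN N) (\<lambda>x. ennreal
     ((2 * pi) powr (- real N / 2) * mat_det N Cov powr (-1/2)
      * exp (- (1/2) * (\<Sum>i<N. \<Sum>j<N. x i * mat_inv N Cov i j * x j))))"

definition converges_in_distr ::
  "nat \<Rightarrow> ('i \<Rightarrow> (nat \<Rightarrow> real) measure) \<Rightarrow> 'i filter \<Rightarrow> (nat \<Rightarrow> real) measure \<Rightarrow> bool" where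
  "converges_in_distr N mu F nu \<longleftrightarrow>
     (\<forall>g :: (nat \<Rightarrow> real) \<Rightarrow> real.
        continuous_on (PiE {..<N} (\<lambda>_. UNIV)) g \<and> bounded (g ` PiE {..<N} (\<lambda>_. UNIV)) \<longrightarrow>
        ((\<lambda>i. \<integral>x. g x \<partial>(mu i)) \<longlongrightarrow> (\<integral>x. g x \<partial>nu)) F)"

definition ordered_cube :: "nat \<Rightarrow> (nat \<Rightarrow> real) set" where
  "ordered_cube N = {x \<in> PiE {..<N} (\<lambda>_. UNIV).
      (\<forall>i<N. -1 \<le> x i \<and> x i \<le> 1) \<and> (\<forall>i j. i \<le> j \<and> j < N \<longrightarrow> x i \<le> x j)}"

definition jacobi_weight :: "nat \<Rightarrow> real \<Rightarrow> real \<Rightarrow> real \<Rightarrow> (nat \<Rightarrow> real) \<Rightarrow> real" where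
  "jacobi_weight N a b \<kappa> x =
     indicator (ordered_cube N) x
     * (\<Prod>j<N. \<Prod>i<j. (x j - x i) powr \<kappa>)
     * (\<Prod>i<N. (1 - x i) powr (\<kappa> * (a + b) / 2 - 1/2) * (1 + x i) powr (\<kappa> * b / 2 - 1/2))"

end

theory Submission
  imports Defs "Jordan_Normal_Form.Determinant" "HOL-Real_Asymp.Real_Asymp"
begin

text \<open>
  The density is \<open>exp (\<kappa> * W x)\<close> times a factor independent of \<open>\<kappa>\<close>, where
  \<open>W\<close> is a strictly concave logarithmic energy. By compactness \<open>W\<close> has a maximizer
  in the open simplex. Stieltjes' argument turns the equations \<open>grad W = 0\<close> into the Jacobi
  differential equation for the polynomial whose roots are the coordinates of the maximizer;
  as the polynomial solution of degree \<open>N\<close> is unique up to a scalar, the maximizer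
  is \<open>z\<close>. Laplace's method at \<open>z\<close>, where minus the Hessian of \<open>W\<close> is \<open>S\<close>,
  then gives the Gaussian limit: the rescaled densities converge pointwise and, after part
  of the exponent has absorbed the edge singularities, are dominated by a Gaussian. The unknown
  normalizing constants drop out by dividing by the case of the constant test function.
\<close>

section \<open>Gaussian integrals\<close>

text \<open>The hypotheses describe \<open>z\<close> only through the zero set of the polynomial.
  That this set consists of \<open>N\<close> distinct points of the open interval is an outcome of
  the argument: the maximizer supplies \<open>N\<close> such zeros. Uniqueness enters through the
  differential equation, because every critical point in the open simplex has exactly the zeros as
  its coordinates. The energy is a sum of logarithms of affine functions. Subtracting its derivative
  at \<open>z\<close>, which vanishes, splits \<open>energy N a b x - energy N a b z\<close> into
  one-variable gaps \<open>ln p - ln q - (p - q) / q\<close>. The whole Laplace argument is thereby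
  scalar: one expansion of the gap gives the pointwise limit, and one inequality for it, valid for
  all arguments in ]0,2[, gives a Gaussian bound on the entire simplex that treats points near
  \<open>z\<close> and far from \<open>z\<close> alike. The Gaussian integral is computed in the
  same elementary spirit, by completing the square in one coordinate at a time.\<close>

definition qform :: "nat \<Rightarrow> (nat \<Rightarrow> nat \<Rightarrow> real) \<Rightarrow> (nat \<Rightarrow> real) \<Rightarrow> real" where
  "qform N S y = (\<Sum>i<N. \<Sum>j<N. y i * S i j * y j)"

definition posdef :: "nat \<Rightarrow> (nat \<Rightarrow> nat \<Rightarrow> real) \<Rightarrow> bool" where
  "posdef N S \<longleftrightarrow> (\<forall>i<N. \<forall>j<N. S i j = S j i) \<and> (\<forall>y. (\<exists>i<N. y i \<noteq> 0) \<longrightarrow> qform N S y > 0)"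

section \<open>Determinants and inverses of matrices encoded as functions\<close>

abbreviation to_mat :: "nat \<Rightarrow> (nat \<Rightarrow> nat \<Rightarrow> real) \<Rightarrow> real Matrix.mat" where
  "to_mat N S \<equiv> Matrix.mat N N (\<lambda>(i, j). S i j)"

lemma mat_det_eq_det: "mat_det N S = Determinant.det (to_mat N S)"
proof -
  have "(\<Prod>i<N. S i (p i)) = (\<Prod>i<N. to_mat N S $$ (i, p i))" if "p permutes {..<N}" for p
    using permutes_in_image[OF that] by (intro prod.cong) auto
  then show ?thesis
    by (simp add: mat_det_def det_def'[of _ N] atLeast0LessThan)
qed

lemma to_mat_mult: "to_mat N A * to_mat N B = to_mat N (\<lambda>i j. \<Sum>k<N. A i k * B k j)"
  by (rule eq_matI) (auto simp: scalar_prod_def atLeast0LessThan intro!: sum.cong)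

lemma is_inverse_mat_det:
  assumes "is_inverse N A B"
  shows "mat_det N A * mat_det N B = 1"
proof -
  have "mat_det N A * mat_det N B = Determinant.det (to_mat N A * to_mat N B)"
    unfolding mat_det_eq_det by (rule det_mult[symmetric]) auto
  also have "to_mat N A * to_mat N B = 1\<^sub>m N"
    unfolding to_mat_mult using assms by (intro eq_matI) (auto simp: is_inverse_def)
  finally show ?thesis by simp
qed

text \<open>The inverse is the adjugate divided by the determinant. The argument order makes
  \<open>T\<close> the future covariance matrix, with \<open>S\<close> as its inverse.\<close>

lemma is_inverse_exists:
  assumes "mat_det N S \<noteq> 0"
  shows "\<exists>T. is_inverse N T S"
proof -
  define d where "d = mat_det N S"
  define A where "A = adj_mat (to_mat N S)"
  define T where "T i j = A $$ (i, j) / d" for i j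
  have A: "A \<in> carrier_mat N N" "to_mat N S * A = d \<cdot>\<^sub>m 1\<^sub>m N" "A * to_mat N S = d \<cdot>\<^sub>m 1\<^sub>m N"
    using adj_mat[of "to_mat N S" N] by (simp_all add: A_def d_def mat_det_eq_det)
  have "(\<Sum>k<N. S i k * T k j) = (if i = j then 1 else 0)"
       "(\<Sum>k<N. T i k * S k j) = (if i = j then 1 else 0)" if ij: "i < N" "j < N" for i j
  proof -
    have "(\<Sum>k<N. S i k * A $$ (k, j)) = (to_mat N S * A) $$ (i, j)"
      using ij A(1) by (auto simp: scalar_prod_def atLeast0LessThan intro!: sum.cong)
    then show "(\<Sum>k<N. S i k * T k j) = (if i = j then 1 else 0)"
      using ij assms unfolding A by (simp add: T_def d_def sum_divide_distrib[symmetric])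
    have "(\<Sum>k<N. A $$ (i, k) * S k j) = (A * to_mat N S) $$ (i, j)"
      using ij A(1) by (auto simp: scalar_prod_def atLeast0LessThan intro!: sum.cong)
    then show "(\<Sum>k<N. T i k * S k j) = (if i = j then 1 else 0)"
      using ij assms unfolding A by (simp add: T_def d_def sum_divide_distrib[symmetric])
  qed
  then have "is_inverse N T S" by (simp add: is_inverse_def)
  then show ?thesis by blast
qed

text \<open>Inverses are determined only on indices below \<open>N\<close>, so the choice behind
  \<open>mat_inv\<close> need not return the function \<open>S\<close> itself. The usual chain
  \<open>R = R (T S) = (R T) S = S\<close> still fixes the relevant entries.\<close>

lemma mat_inv_eq:
  assumes "is_inverse N T S" and ij: "i < N" "j < N"
  shows "mat_inv N T i j = S i j"
proof -
  define R where "R = mat_inv N T"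
  have R: "is_inverse N T R" unfolding R_def mat_inv_def by (rule someI[of "is_inverse N T", OF assms(1)])
  have "R i j = (\<Sum>k<N. R i k * (if k = j then 1 else 0))"
    using ij by (simp add: if_distrib cong: if_cong)
  also have "\<dots> = (\<Sum>k<N. \<Sum>l<N. R i k * (T k l * S l j))"
    using assms unfolding sum_distrib_left[symmetric] by (intro sum.cong) (auto simp: is_inverse_def)
  also have "\<dots> = (\<Sum>l<N. (\<Sum>k<N. R i k * T k l) * S l j)"
    by (subst sum.swap) (simp add: sum_distrib_right mult.assoc)
  also have "\<dots> = (\<Sum>l<N. (if i = l then 1 else 0) * S l j)"
    using R ij by (intro sum.cong) (auto simp: is_inverse_def)
  also have "\<dots> = S i j" using ij by (simp add: if_distrib[of "\<lambda>x. x * _"] cong: if_cong)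
  finally show ?thesis by (simp add: R_def)
qed

section \<open>Schur complements\<close>

definition schur :: "nat \<Rightarrow> (nat \<Rightarrow> nat \<Rightarrow> real) \<Rightarrow> nat \<Rightarrow> nat \<Rightarrow> real" where
  "schur N S i j = S i j - S i N * S N j / S N N"

text \<open>Elimination of the last column: \<open>S = L B\<close>, where \<open>L\<close> is upper
  triangular with unit diagonal and \<open>B\<close> is block lower triangular with diagonal blocks
  \<open>schur N S\<close> and \<open>S N N\<close>.\<close>

lemma mat_det_schur:
  assumes s: "S N N \<noteq> 0"
  shows "mat_det (Suc N) S = mat_det N (schur N S) * S N N"
proof -
  define L where "L i j = (if i = j then 1 else if j = N then S i N / S N N else 0)" for i j
  define B where "B i j = (if i < N then if j < N then schur N S i j else 0 else S i j)" for i j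
  have "to_mat (Suc N) S = to_mat (Suc N) L * to_mat (Suc N) B"
    unfolding to_mat_mult
  proof (rule eq_matI)
    fix i j
    assume "i < dim_row (to_mat (Suc N) (\<lambda>i j. \<Sum>k<Suc N. L i k * B k j))"
      and "j < dim_col (to_mat (Suc N) (\<lambda>i j. \<Sum>k<Suc N. L i k * B k j))"
    then have ij: "i < Suc N" "j < Suc N" by simp_all
    have "(\<Sum>k<N. L i k * B k j) = (\<Sum>k<N. if k = i then B k j else 0)"
      by (rule sum.cong) (auto simp: L_def)
    also have "\<dots> = (if i < N then B i j else 0)" by simp
    finally have e: "(\<Sum>k<N. L i k * B k j) = (if i < N then B i j else 0)" .
    have "S i j = (if i < N then B i j else 0) + L i N * B N j"
      using ij s by (auto simp: L_def B_def schur_def less_Suc_eq)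
    then have "S i j = (\<Sum>k<N. L i k * B k j) + L i N * B N j" unfolding e .
    then show "to_mat (Suc N) S $$ (i, j) = to_mat (Suc N) (\<lambda>i j. \<Sum>k<Suc N. L i k * B k j) $$ (i, j)"
      using ij by simp
  qed simp_all
  then have "mat_det (Suc N) S = Determinant.det (to_mat (Suc N) L) * Determinant.det (to_mat (Suc N) B)"
    unfolding mat_det_eq_det by (simp add: det_mult[of _ "Suc N"])
  also have "Determinant.det (to_mat (Suc N) L) = 1"
  proof -
    have "upper_triangular (to_mat (Suc N) L)"
      by (auto simp: upper_triangular_def L_def)
    then have "Determinant.det (to_mat (Suc N) L) = prod_list (diag_mat (to_mat (Suc N) L))"
      by (rule det_upper_triangular[where n = "Suc N"]) simp
    also have "diag_mat (to_mat (Suc N) L) = map (\<lambda>_. 1) [0..<Suc N]"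
      unfolding diag_mat_def by (rule map_cong) (auto simp: L_def)
    finally show ?thesis by (simp add: map_replicate_const)
  qed
  also have "to_mat (Suc N) B = four_block_mat (to_mat N (schur N S)) (0\<^sub>m N 1)
      (Matrix.mat 1 N (\<lambda>(i, j). S N j)) (Matrix.mat 1 1 (\<lambda>_. S N N))"
    by (rule eq_matI) (auto simp: B_def less_Suc_eq)
  also have "Determinant.det \<dots> = Determinant.det (to_mat N (schur N S)) * Determinant.det (Matrix.mat 1 1 (\<lambda>_. S N N))"
    by (rule det_four_block_mat_upper_right_zero_col) auto
  also have "Determinant.det (Matrix.mat 1 1 (\<lambda>_. S N N)) = S N N"
    by (simp add: det_single)
  finally show ?thesis by (simp add: mat_det_eq_det)
qed

text \<open>Completing the square in coordinate \<open>N\<close>; the Schur complement is the matrix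
  of what remains in the other coordinates.\<close>

lemma qform_schur:
  assumes sym: "\<And>i j. i \<le> N \<Longrightarrow> j \<le> N \<Longrightarrow> S i j = S j i" and s: "S N N \<noteq> 0"
  shows "qform (Suc N) S y = S N N * (y N + (\<Sum>i<N. S i N * y i) / S N N)\<^sup>2 + qform N (schur N S) y"
proof -
  define r where "r = (\<Sum>i<N. S i N * y i)"
  have r': "(\<Sum>i<N. S N i * y i) = r" unfolding r_def by (intro sum.cong) (auto simp: sym)
  have "qform (Suc N) S y = qform N S y + 2 * y N * r + y N * S N N * y N"
  proof -
    have "(\<Sum>i<N. y i * S i N * y N) = y N * r" "(\<Sum>j<N. y N * S N j * y j) = y N * r"
      unfolding sum_distrib_left r_def by (auto intro!: sum.cong simp: sym[of N])
    then show ?thesis by (simp add: qform_def sum.distrib)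
  qed
  moreover have "qform N (schur N S) y = qform N S y - r * r / S N N"
  proof -
    have "r * r = (\<Sum>i<N. S i N * y i) * (\<Sum>j<N. S N j * y j)" by (simp only: r' r_def)
    also have "\<dots> = (\<Sum>i<N. \<Sum>j<N. y i * (S i N * S N j) * y j)"
      unfolding sum_product by (intro sum.cong refl) (simp add: mult_ac)
    finally have "r * r = (\<Sum>i<N. \<Sum>j<N. y i * (S i N * S N j) * y j)" .
    then show ?thesis
      by (simp add: qform_def schur_def algebra_simps sum_subtractf sum_divide_distrib)
  qed
  moreover have "S N N * (y N + r / S N N)\<^sup>2 = y N * S N N * y N + 2 * y N * r + r * r / S N N"
    using s by (simp add: power2_eq_square field_simps)
  ultimately show ?thesis
    unfolding r_def[symmetric] by simp
qed

lemma posdef_schur: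
  assumes "posdef (Suc N) S"
  shows "S N N > 0" "posdef N (schur N S)"
proof -
  have sym: "S i j = S j i" if "i \<le> N" "j \<le> N" for i j
    using assms that by (simp add: posdef_def)
  have pos: "qform (Suc N) S y > 0" if "\<exists>i<Suc N. y i \<noteq> 0" for y
    using assms that unfolding posdef_def by blast
  have "qform (Suc N) S (\<lambda>i. if i = N then 1 else 0) = S N N"
    by (simp add: qform_def)
  then show s: "S N N > 0" using pos[of "\<lambda>i. if i = N then 1 else 0"] by auto
  show "posdef N (schur N S)"
    unfolding posdef_def
  proof safe
    fix i j assume "i < N" "j < N"
    then show "schur N S i j = schur N S j i"
      using sym[of i j] sym[of i N] sym[of j N] by (simp add: schur_def)
  next
    fix y :: "nat \<Rightarrow> real" and i assume i: "i < N" "y i \<noteq> 0"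
    \<comment> \<open>With this last coordinate the square in \<open>qform_schur\<close> vanishes,
      so positivity of the large form passes to the Schur form.\<close>
    define y' where "y' = y(N := - (\<Sum>i<N. S i N * y i) / S N N)"
    have "(\<Sum>i<N. S i N * y' i) = (\<Sum>i<N. S i N * y i)" "qform N (schur N S) y' = qform N (schur N S) y"
      unfolding qform_def y'_def by (auto intro!: sum.cong)
    then have "qform (Suc N) S y' = qform N (schur N S) y"
      using s by (subst qform_schur) (auto simp: sym y'_def)
    moreover have "qform (Suc N) S y' > 0"
      using i by (intro pos exI[of _ i]) (auto simp: y'_def)
    ultimately show "qform N (schur N S) y > 0" by simp
  qed
qed

section \<open>The Gaussian integral\<close>

lemma space_RN: "space (RN N) = PiE {..<N} (\<lambda>_. UNIV)"
  by (simp add: RN_def space_PiM)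

lemma measurable_RN_component [measurable]: "i < N \<Longrightarrow> (\<lambda>x. x i) \<in> borel_measurable (RN N)"
  unfolding RN_def by measurable

lemma borel_measurable_qform [measurable]: "qform N S \<in> borel_measurable (RN N)"
  unfolding qform_def[abs_def] by measurable

lemma nn_integral_gaussian_shift:
  assumes "s > 0"
  shows "(\<integral>\<^sup>+t. ennreal (exp (- (1/2) * (s * (t + m)\<^sup>2))) \<partial>lborel) = ennreal (sqrt (2 * pi / s))"
proof -
  define \<sigma> where "\<sigma> = 1 / sqrt s"
  have \<sigma>: "\<sigma> > 0" "\<sigma>\<^sup>2 = 1 / s" using assms by (simp_all add: \<sigma>_def power_divide)
  have "exp (- (1/2) * (s * (t + m)\<^sup>2)) = sqrt (2 * pi / s) * normal_density (- m) \<sigma> t" for t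
    unfolding normal_density_def \<sigma>(2) using assms by simp
  then have "(\<integral>\<^sup>+t. ennreal (exp (- (1/2) * (s * (t + m)\<^sup>2))) \<partial>lborel)
      = ennreal (sqrt (2 * pi / s)) * (\<integral>\<^sup>+t. ennreal (normal_density (- m) \<sigma> t) \<partial>lborel)"
    using assms by (simp add: ennreal_mult nn_integral_cmult)
  also have "(\<integral>\<^sup>+t. ennreal (normal_density (- m) \<sigma> t) \<partial>lborel) = 1"
    using \<sigma> by (subst nn_integral_eq_integral) (simp_all add: integral_normal_density)
  finally show ?thesis by simp
qed

text \<open>Induction on the dimension, integrating the last coordinate innermost. By
  \<open>qform_schur\<close> the inner integrand is a one-dimensional Gaussian whose shift depends
  on the other coordinates while its mass does not. The Schur form that is left is again positive
  definite, and the determinants multiply. Working with nonnegative integrals gives integrability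
  along the way.\<close>

lemma gaussian_integral:
  assumes "posdef N S"
  shows "mat_det N S > 0"
    "(\<integral>\<^sup>+y. ennreal (exp (- (1/2) * qform N S y)) \<partial>RN N)
       = ennreal ((2 * pi) powr (real N / 2) * mat_det N S powr (- 1/2))"
proof -
  interpret product_sigma_finite "\<lambda>_::nat. lborel :: real measure" ..
  have "mat_det N S > 0 \<and> (\<integral>\<^sup>+y. ennreal (exp (- (1/2) * qform N S y)) \<partial>RN N)
       = ennreal ((2 * pi) powr (real N / 2) * mat_det N S powr (- 1/2))"
    using assms
  proof (induction N arbitrary: S)
    case 0
    have "{p. p permutes {..<0::nat}} = {id}" by (auto simp: permutes_empty)
    then show ?case by (simp add: mat_det_def RN_def space_PiM_empty qform_def)
  next
    case (Suc N)
    note s = posdef_schur[OF Suc.prems]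
    define D where "D = mat_det N (schur N S)"
    have D: "D > 0" and IH: "(\<integral>\<^sup>+y. ennreal (exp (- (1/2) * qform N (schur N S) y)) \<partial>RN N)
       = ennreal ((2 * pi) powr (real N / 2) * D powr (- 1/2))"
      using Suc.IH[OF s(2)] by (simp_all add: D_def)
    have det: "mat_det (Suc N) S = D * S N N" using mat_det_schur[of S N] s by (simp add: D_def)
    have sym: "S i j = S j i" if "i \<le> N" "j \<le> N" for i j
      using Suc.prems that by (simp add: posdef_def)
    have RN: "RN (Suc N) = PiM (insert N {..<N}) (\<lambda>_. lborel)" by (simp add: RN_def lessThan_Suc)
    have "(\<integral>\<^sup>+y. ennreal (exp (- (1/2) * qform (Suc N) S y)) \<partial>RN (Suc N))
       = (\<integral>\<^sup>+x. (\<integral>\<^sup>+t. ennreal (exp (- (1/2) * qform (Suc N) S (x(N := t)))) \<partial>lborel) \<partial>RN N)"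
      unfolding RN by (subst product_nn_integral_insert) (auto simp: RN_def[symmetric] RN[symmetric])
    also have "\<dots> = (\<integral>\<^sup>+x. ennreal (sqrt (2 * pi / S N N)) * ennreal (exp (- (1/2) * qform N (schur N S) x)) \<partial>RN N)"
    proof (rule nn_integral_cong)
      fix x
      define m where "m = (\<Sum>i<N. S i N * x i) / S N N"
      have "qform (Suc N) S (x(N := t)) = S N N * (t + m)\<^sup>2 + qform N (schur N S) x" for t
        using s by (subst qform_schur) (auto simp: sym m_def qform_def intro!: sum.cong)
      then have "ennreal (exp (- (1/2) * qform (Suc N) S (x(N := t)))) =
          ennreal (exp (- (1/2) * qform N (schur N S) x)) * ennreal (exp (- (1/2) * (S N N * (t + m)\<^sup>2)))" for t
        by (simp add: ennreal_mult[symmetric] exp_add[symmetric] algebra_simps)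
      then show "(\<integral>\<^sup>+t. ennreal (exp (- (1/2) * qform (Suc N) S (x(N := t)))) \<partial>lborel) =
          ennreal (sqrt (2 * pi / S N N)) * ennreal (exp (- (1/2) * qform N (schur N S) x))"
        using nn_integral_gaussian_shift[OF s(1), of m] by (simp add: nn_integral_cmult mult.commute)
    qed
    also have "\<dots> = ennreal (sqrt (2 * pi / S N N)) * ennreal ((2 * pi) powr (real N / 2) * D powr (- 1/2))"
      by (subst nn_integral_cmult) (simp_all only: IH, measurable)
    also have "\<dots> = ennreal (sqrt (2 * pi / S N N) * ((2 * pi) powr (real N / 2) * D powr (- 1/2)))"
      using s by (simp add: ennreal_mult)
    also have "sqrt (2 * pi / S N N) * ((2 * pi) powr (real N / 2) * D powr (- 1/2))
        = (2 * pi) powr (real (Suc N) / 2) * (D * S N N) powr (- 1/2)"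
    proof -
      have "sqrt (2 * pi / S N N) = (2 * pi) powr (1 / 2) * S N N powr (- 1 / 2)"
        using s by (simp add: powr_minus_divide powr_half_sqrt real_sqrt_divide)
      moreover have "(2 * pi) powr (real (Suc N) / 2) = (2 * pi) powr (1 / 2) * (2 * pi) powr (real N / 2)"
        unfolding powr_add[symmetric] by (simp add: add_divide_distrib)
      ultimately show ?thesis using s D by (simp add: powr_mult mult_ac)
    qed
    finally show ?case using D s det by simp
  qed
  then show "mat_det N S > 0"
    "(\<integral>\<^sup>+y. ennreal (exp (- (1/2) * qform N S y)) \<partial>RN N)
       = ennreal ((2 * pi) powr (real N / 2) * mat_det N S powr (- 1/2))" by blast+
qed

section \<open>The Jacobi differential equation\<close>

hide_const (open) module.smult

text \<open>The classical operator \<open>(1 - x^2) q'' + (\<beta> - \<alpha> - (\<alpha> + \<beta>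
  + 2) x) q' + N (N + \<alpha> + \<beta> + 1) q\<close> for \<open>\<alpha> = a + b - 1\<close> and
  \<open>\<beta> = b - 1\<close>.\<close>

definition jacobi_op :: "nat \<Rightarrow> real \<Rightarrow> real \<Rightarrow> real poly \<Rightarrow> real poly" where
  "jacobi_op N a b q = [:1, 0, -1:] * pderiv (pderiv q) + [:- a, - (a + 2 * b):] * pderiv q
     + smult (real N * (real N + a + 2 * b - 1)) q"

lemma jacobi_op_add: "jacobi_op N a b (p + q) = jacobi_op N a b p + jacobi_op N a b q"
  by (simp add: jacobi_op_def pderiv_add algebra_simps smult_add_right)

lemma jacobi_op_smult: "jacobi_op N a b (smult c q) = smult c (jacobi_op N a b q)"
  unfolding jacobi_op_def pderiv_smult mult_smult_right smult_add_right smult_smult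
  by (simp only: mult.commute)

lemma jacobi_op_0 [simp]: "jacobi_op N a b 0 = 0"
  by (simp add: jacobi_op_def)

lemma jacobi_op_diff: "jacobi_op N a b (p - q) = jacobi_op N a b p - jacobi_op N a b q"
  using jacobi_op_add[of N a b p "smult (-1) q"] jacobi_op_smult[of N a b "-1" q] by simp

lemma jacobi_op_sum: "jacobi_op N a b (\<Sum>i\<in>I. f i) = (\<Sum>i\<in>I. jacobi_op N a b (f i))"
  by (induction I rule: infinite_finite_induct) (simp_all add: jacobi_op_add)

text \<open>The operator is upper triangular in the monomial basis. Its diagonal entry has the
  factor \<open>real N - real m\<close>, which lowers the degree of the image of a polynomial of
  degree \<open>N\<close> and forces uniqueness of the solution.\<close>

lemma coeff_jacobi_op:
  "coeff (jacobi_op N a b q) m =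
     (real m + 2) * (real m + 1) * coeff q (m + 2) - a * (real m + 1) * coeff q (m + 1)
     + (real N - real m) * (real N + real m + a + 2 * b - 1) * coeff q m"
  by (cases m; cases "m - 1")
     (auto simp: jacobi_op_def coeff_pderiv coeff_pCons algebra_simps split: nat.splits)

text \<open>A nonzero solution would have degree \<open>m < N\<close>, and then its leading
  coefficient is multiplied by a nonzero diagonal entry and survives in the image.\<close>

lemma jacobi_op_eq_0_imp:
  assumes "a + 2 * b > 0" and "jacobi_op N a b q = 0" and "degree q \<le> N" and "coeff q N = 0"
  shows "q = 0"
proof (rule ccontr)
  assume q: "q \<noteq> 0"
  define m where "m = degree q"
  have m: "m < N"
    using assms(3,4) q by (metis m_def le_neq_implies_less leading_coeff_0_iff)
  have "coeff (jacobi_op N a b q) m = (real N - real m) * (real N + real m + a + 2 * b - 1) * coeff q m"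
    by (simp add: coeff_jacobi_op coeff_eq_0 m_def)
  \<comment> \<open>This is what keeps the second factor positive when
    \<open>a + 2 * b < 1\<close>.\<close>
  moreover have "real N \<ge> 1" using m by simp
  then have "real N + real m + a + 2 * b - 1 > 0" using assms(1) by linarith
  ultimately show False using assms(2) m q by (simp add: m_def)
qed

text \<open>In the variables \<open>u = (x - 1) / 2\<close> and \<open>v = (x + 1) / 2\<close> one
  has \<open>1 - x^2 = - 4 u v\<close>, and the operator couples the product
  \<open>u ^ k * v ^ l\<close> only to its two neighbours of the same total degree. Writing the
  image through differences prepares the cancellation in
  \<open>jacobi_op_jacobi_poly\<close>.\<close>

lemma jacobi_op_basis:
  fixes k l :: nat and a b :: real
  defines "u \<equiv> [:-1/2, 1/2:] :: real poly" and "v \<equiv> [:1/2, 1/2:] :: real poly"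
  shows "jacobi_op (k + l) a b (u ^ k * v ^ l) =
     smult (real k * (real k + a + b - 1)) (u ^ k * v ^ l - u ^ (k - 1) * v ^ (l + 1))
   + smult (real l * (real l + b - 1)) (u ^ k * v ^ l - u ^ (k + 1) * v ^ (l - 1))"
proof -
  define f where "f = u ^ k * v ^ l"
  \<comment> \<open>The scalars become constant polynomials, so that the final identity lives in a
    single commutative ring.\<close>
  define K L A B :: "real poly"
    where "K = [:real k:]" and "L = [:real l:]" and "A = [:a:]" and "B = [:b:]"
  have du: "2 * pderiv u = 1" "2 * pderiv v = 1" and vu: "v = u + 1"
    by (simp_all add: u_def v_def pderiv_pCons one_pCons numeral_poly)
  \<comment> \<open>Multiplied by \<open>u\<close>, the derivative of the power is a multiple of the
    power itself, and no truncated exponent \<open>k - 1\<close> appears.\<close>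
  have pu: "2 * u * pderiv (u ^ k) = K * u ^ k"
  proof (cases k)
    case (Suc n)
    have "2 * u * pderiv (u ^ k) = smult (real k) (u ^ n * u) * (2 * pderiv u)"
      unfolding Suc pderiv_power_Suc by (simp add: algebra_simps)
    then show ?thesis unfolding du by (simp add: Suc K_def mult.commute)
  qed (simp add: K_def)
  have pv: "2 * v * pderiv (v ^ l) = L * v ^ l"
  proof (cases l)
    case (Suc n)
    have "2 * v * pderiv (v ^ l) = smult (real l) (v ^ n * v) * (2 * pderiv v)"
      unfolding Suc pderiv_power_Suc by (simp add: algebra_simps)
    then show ?thesis unfolding du by (simp add: Suc L_def mult.commute)
  qed (simp add: L_def)
  have d1: "2 * u * v * pderiv f = (K * v + L * u) * f"
  proof -
    have "2 * u * v * pderiv f = (2 * u * pderiv (u ^ k)) * v * v ^ l + (2 * v * pderiv (v ^ l)) * u * u ^ k"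
      unfolding f_def pderiv_mult by (simp add: algebra_simps)
    then show ?thesis unfolding pu pv f_def by (simp add: algebra_simps)
  qed
  have K': "pderiv K = 0" "pderiv L = 0" "pderiv (2::real poly) = 0"
    by (simp_all add: K_def L_def numeral_poly pderiv_pCons)
  have "2 * pderiv (2 * u * v * pderiv f) = 2 * pderiv ((K * v + L * u) * f)"
    unfolding d1 by simp
  then have "2 * (2 * pderiv u) * v * pderiv f + 2 * u * (2 * pderiv v) * pderiv f + 4 * u * v * pderiv (pderiv f)
      = (K * (2 * pderiv v) + L * (2 * pderiv u)) * f + 2 * (K * v + L * u) * pderiv f"
    by (simp add: pderiv_mult pderiv_add K' algebra_simps)
  then have d2: "2 * v * pderiv f + 2 * u * pderiv f + 4 * u * v * pderiv (pderiv f)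
      = (K + L) * f + 2 * (K * v + L * u) * pderiv f"
    unfolding du by simp
  define g h where "g = u ^ (k - 1) * v ^ (l + 1)" and "h = u ^ (k + 1) * v ^ (l - 1)"
  \<comment> \<open>For \<open>k = 0\<close> the exponent \<open>k - 1\<close> is truncated and
    \<open>u * g = v * f\<close> fails, but the factor \<open>K\<close> is then zero; likewise for
    \<open>h\<close> and \<open>L\<close>.\<close>
  have g: "K * (u * g) = K * (v * f)"
    by (cases k) (simp_all add: K_def g_def f_def algebra_simps)
  have h: "L * (v * h) = L * (u * f)"
    by (cases l) (simp_all add: L_def h_def f_def algebra_simps)
  have uv0: "u * v \<noteq> 0" by (simp add: u_def v_def)
  have lhs: "jacobi_op (k + l) a b f = - (4 * u * v * pderiv (pderiv f))
      - 2 * ((A + B) * v + B * u) * pderiv f + (K + L) * (K + L + A + 2 * B - 1) * f"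
  proof -
    have 1: "[:1, 0, -1:] = - (4 * u * v)"
      by (simp add: u_def v_def numeral_poly)
    have 2: "[:- a, - (a + 2 * b):] = - 2 * ((A + B) * v + B * u)"
      by (simp add: u_def v_def numeral_poly A_def B_def field_simps)
    have 3: "smult (real (k + l) * (real (k + l) + a + 2 * b - 1)) f = (K + L) * (K + L + A + 2 * B - 1) * f"
    proof -
      have "(K + L) * (K + L + A + 2 * B - 1) = [:real (k + l) * (real (k + l) + a + 2 * b - 1):]"
        by (simp add: K_def L_def A_def B_def numeral_poly one_pCons algebra_simps)
      then show ?thesis by simp
    qed
    show ?thesis unfolding jacobi_op_def 1 2 3 by (simp add: algebra_simps)
  qed
  have 4: "smult (real k * (real k + a + b - 1)) q = K * (K + A + B - 1) * q" for q
  proof -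
    have "K * (K + A + B - 1) = [:real k * (real k + a + b - 1):]"
      by (simp add: K_def A_def B_def one_pCons)
    then show ?thesis by simp
  qed
  have 5: "smult (real l * (real l + b - 1)) q = L * (L + B - 1) * q" for q
  proof -
    have "L * (L + B - 1) = [:real l * (real l + b - 1):]"
      by (simp add: L_def B_def one_pCons)
    then show ?thesis by simp
  qed
  \<comment> \<open>The factor \<open>u * v\<close> brings every term into the reach of
    \<open>d1\<close>, \<open>d2\<close>, \<open>g\<close> and \<open>h\<close>; it is cancelled
    afterwards.\<close>
  have "(u * v) * (jacobi_op (k + l) a b f) =
      (u * v) * (K * (K + A + B - 1) * (f - g) + L * (L + B - 1) * (f - h))"
    unfolding lhs using d1 d2 g h vu by Groebner_Basis.algebra
  then have "jacobi_op (k + l) a b f = K * (K + A + B - 1) * (f - g) + L * (L + B - 1) * (f - h)"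
    using uv0 by (metis mult_cancel_left)
  then show ?thesis unfolding 4 5 by (simp add: f_def g_def h_def)
qed

section \<open>The Jacobi polynomial solves the equation\<close>

definition jacobi_poly :: "nat \<Rightarrow> real \<Rightarrow> real \<Rightarrow> real poly" where
  "jacobi_poly N al be = (\<Sum>k\<le>N. smult (((real N + al) gchoose (N - k)) * ((real N + be) gchoose k))
     ([:-1/2, 1/2:] ^ k * [:1/2, 1/2:] ^ (N - k)))"

lemma poly_jacobi_poly: "poly (jacobi_poly N al be) x = jacobiP N al be x"
proof -
  have e: "poly [:-1/2, 1/2:] x = (x - 1) / 2" "poly [:1/2, 1/2:] x = (x + 1) / 2"
    by (simp_all add: field_simps)
  show ?thesis
    unfolding jacobi_poly_def jacobiP_def poly_sum poly_smult poly_mult poly_power e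
    by (simp add: mult.assoc)
qed

lemma degree_jacobi_poly: "degree (jacobi_poly N al be) \<le> N"
  unfolding jacobi_poly_def
proof (rule degree_sum_le, simp)
  fix k assume "k \<in> {..N}"
  then have k: "k \<le> N" by simp
  have "degree ([:-1/2, 1/2:] ^ k * [:1/2, 1/2:] ^ (N - k) :: real poly)
      \<le> degree ([:-1/2, 1/2:] ^ k :: real poly) + degree ([:1/2, 1/2:] ^ (N - k) :: real poly)"
    by (rule degree_mult_le)
  also have "\<dots> \<le> N" using k by (simp add: degree_power_eq)
  finally show "degree (smult (((real N + al) gchoose (N - k)) * ((real N + be) gchoose k))
     ([:-1/2, 1/2:] ^ k * [:1/2, 1/2:] ^ (N - k))) \<le> N"
    using degree_smult_le order_trans by blast
qed

lemma gchoose_Suc_mult: "(x gchoose Suc m) * (real m + 1) = (x gchoose m) * (x - real m)" for x :: real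
  using gbinomial_absorption'[of "Suc m" x] gbinomial_mult_1[of x m] 
  by (simp add: algebra_simps)

text \<open>A detailed-balance argument: by \<open>jacobi_op_basis\<close> the term \<open>k\<close>
  contributes multiples of \<open>f k - f (k - 1)\<close> and \<open>f k - f (k + 1)\<close>. The
  recursion for \<open>d\<close> says that the step from \<open>k\<close> up to \<open>k + 1\<close>
  has the same coefficient, \<open>r (Suc k)\<close>, as the step from \<open>k + 1\<close> down to
  \<open>k\<close>, so opposite differences cancel in pairs.\<close>

lemma jacobi_op_jacobi_poly: "jacobi_op N a b (jacobi_poly N (a + b - 1) (b - 1)) = 0"
proof -
  define d where "d k = ((real N + (a + b - 1)) gchoose (N - k)) * ((real N + (b - 1)) gchoose k)" for k
  define f :: "nat \<Rightarrow> real poly" where "f k = [:-1/2, 1/2:] ^ k * [:1/2, 1/2:] ^ (N - k)" for k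
  define r where "r k = real k * (real k + a + b - 1) * d k" for k
  have rec: "r (Suc k) = (real N - real k) * (real N - real k + b - 1) * d k" if k: "k < N" for k
  proof -
    obtain m where m: "N = Suc (k + m)" using k less_iff_Suc_add by auto
    have 1: "((real N + (a + b - 1)) gchoose (N - k)) * (real m + 1)
        = ((real N + (a + b - 1)) gchoose m) * (real k + a + b)"
      using gchoose_Suc_mult[of "real N + (a + b - 1)" m] by (simp add: m algebra_simps)
    have 2: "((real N + (b - 1)) gchoose Suc k) * (real k + 1)
        = ((real N + (b - 1)) gchoose k) * (real N - real k + b - 1)"
      using gchoose_Suc_mult[of "real N + (b - 1)" k] by (simp add: algebra_simps)
    have "r (Suc k) = ((real N + (a + b - 1)) gchoose m) * (real k + a + b)
       * (((real N + (b - 1)) gchoose Suc k) * (real k + 1))"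
      by (simp add: r_def d_def m algebra_simps)
    also have "\<dots> = (real m + 1) * (real N - real k + b - 1) * d k"
      unfolding 1[symmetric] 2 d_def by (simp add: algebra_simps)
    finally show ?thesis by (simp add: m)
  qed
  have "jacobi_op N a b (jacobi_poly N (a + b - 1) (b - 1)) = (\<Sum>k\<le>N. smult (d k) (jacobi_op N a b (f k)))"
    by (simp add: jacobi_poly_def d_def f_def jacobi_op_sum jacobi_op_smult)
  also have "\<dots> = (\<Sum>k\<le>N. smult (r k) (f k - f (k - 1)) + smult (if k < N then r (Suc k) else 0) (f k - f (k + 1)))"
  proof (rule sum.cong[OF refl])
    fix k assume "k \<in> {..N}"
    then have k: "k \<le> N" by simp
    \<comment> \<open>The exponent identity behind this replacement fails only at the end of the
      range, where the scalar factor is zero: \<open>k = 0\<close> here, \<open>k = N\<close> in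
      \<open>f2\<close>.\<close>
    have f1: "smult (real k * c) (f k - [:-1/2, 1/2:] ^ (k - 1) * [:1/2, 1/2:] ^ (N - k + 1))
        = smult (real k * c) (f k - f (k - 1))" for c
      using k by (cases k) (simp_all add: f_def Suc_diff_Suc)
    have f2: "smult (real (N - k) * c) (f k - [:-1/2, 1/2:] ^ (k + 1) * [:1/2, 1/2:] ^ (N - k - 1))
        = smult (real (N - k) * c) (f k - f (k + 1))" for c
      using k by (simp add: f_def)
    have "jacobi_op N a b (f k) = smult (real k * (real k + a + b - 1)) (f k - f (k - 1))
       + smult (real (N - k) * (real (N - k) + b - 1)) (f k - f (k + 1))"
      using jacobi_op_basis[of k "N - k" a b] k unfolding f_def[symmetric] f1 f2 by simp
    moreover have "real (N - k) * (real (N - k) + b - 1) * d k = (if k < N then r (Suc k) else 0)"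
      using k rec[of k] by (auto simp: of_nat_diff)
    ultimately show "smult (d k) (jacobi_op N a b (f k)) =
       smult (r k) (f k - f (k - 1)) + smult (if k < N then r (Suc k) else 0) (f k - f (k + 1))"
      by (simp add: smult_add_right r_def mult_ac)
  qed
  also have "\<dots> = (\<Sum>k\<le>N. smult (r k) (f k - f (k - 1))) + (\<Sum>k<N. smult (r (Suc k)) (f k - f (k + 1)))"
    by (simp add: sum.distrib lessThan_Suc_atMost[symmetric])
  also have "(\<Sum>k\<le>N. smult (r k) (f k - f (k - 1))) = (\<Sum>k<N. smult (r (Suc k)) (f (Suc k) - f k))"
    unfolding lessThan_Suc_atMost[symmetric] sum.lessThan_Suc_shift by (simp add: r_def)
  finally show ?thesis
    by (simp add: sum.distrib[symmetric] smult_diff_right)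
qed

text \<open>At the point \<open>1\<close> only the summand \<open>k = 0\<close> survives; it is a
  binomial coefficient all of whose factors are positive since \<open>al > -1\<close>.\<close>

lemma jacobi_poly_neq_0:
  assumes "al > -1"
  shows "jacobi_poly N al be \<noteq> 0"
proof
  assume 0: "jacobi_poly N al be = 0"
  have "jacobiP N al be 1 = (\<Sum>k\<in>{0::nat}. ((real N + al) gchoose (N - k)) * ((real N + be) gchoose k)
              * ((1 - 1) / 2) ^ k * ((1 + 1) / 2) ^ (N - k))"
    unfolding jacobiP_def by (rule sum.mono_neutral_right) auto
  then have "jacobiP N al be 1 = ((real N + al) gchoose N)" by simp
  moreover have "((real N + al) gchoose N) > 0"
    unfolding gbinomial_prod_rev using assms by (auto intro!: divide_pos_pos prod_pos)
  ultimately show False using poly_jacobi_poly[of N al be 1] 0 by simp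
qed

section \<open>Stieltjes' characterization of the zeros\<close>

text \<open>Splitting off the root gives \<open>p = (x - y j) q\<close>, hence \<open>p' = q\<close>
  and \<open>p'' = 2 q'\<close> at \<open>y j\<close>; the sum is the logarithmic derivative of
  \<open>q\<close>. Its summand \<open>l = j\<close> is \<open>1 / 0 = 0\<close>, in accordance with
  the factor missing from \<open>q\<close>.\<close>

lemma poly_prod_roots_deriv2:
  fixes y :: "nat \<Rightarrow> real"
  assumes inj: "inj_on y {..<N}" and j: "j < N"
  defines "p \<equiv> \<Prod>i<N. [:- y i, 1:]"
  shows "poly (pderiv (pderiv p)) (y j) = 2 * poly (pderiv p) (y j) * (\<Sum>l<N. 1 / (y j - y l))"
proof -
  define q where "q = (\<Prod>i\<in>{..<N} - {j}. [:- y i, 1:])"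
  have p: "p = [:- y j, 1:] * q"
    unfolding p_def q_def using j by (subst prod.remove[of _ j]) auto
  have ne: "y j - y l \<noteq> 0" if "l \<in> {..<N} - {j}" for l
    using inj j that by (auto simp: inj_on_def)
  have d1: "poly (pderiv p) (y j) = poly q (y j)"
    unfolding p pderiv_mult by (simp add: pderiv_pCons)
  have d2: "poly (pderiv (pderiv p)) (y j) = 2 * poly (pderiv q) (y j)"
    unfolding p pderiv_mult by (simp add: pderiv_pCons pderiv_add pderiv_diff pderiv_smult)
  have "poly (pderiv q) (y j) = (\<Sum>l\<in>{..<N} - {j}. \<Prod>i\<in>{..<N} - {j} - {l}. y j - y i)"
    unfolding q_def pderiv_prod by (simp add: poly_sum poly_prod pderiv_pCons)
  also have "\<dots> = (\<Sum>l\<in>{..<N} - {j}. poly q (y j) * (1 / (y j - y l)))"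
  proof (rule sum.cong[OF refl])
    fix l assume l: "l \<in> {..<N} - {j}"
    have "poly q (y j) = (y j - y l) * (\<Prod>i\<in>{..<N} - {j} - {l}. y j - y i)"
      unfolding q_def poly_prod using l by (subst prod.remove[of _ l]) auto
    then show "(\<Prod>i\<in>{..<N} - {j} - {l}. y j - y i) = poly q (y j) * (1 / (y j - y l))"
      using ne[OF l] by simp
  qed
  also have "\<dots> = poly q (y j) * (\<Sum>l<N. 1 / (y j - y l))"
    using j by (subst (2) sum.remove[of _ j]) (auto simp: sum_distrib_left)
  finally show ?thesis using d1 d2 by simp
qed

text \<open>In \<open>crit\<close> the summand for \<open>l = j\<close> is \<open>1 / 0 = 0\<close>.\<close>

lemma jacobiP_zeros:
  fixes y :: "nat \<Rightarrow> real"
  assumes a: "a \<ge> 0" and b: "b > 0"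
    and inj: "inj_on y {..<N}" and y: "\<And>j. j < N \<Longrightarrow> \<bar>y j\<bar> < 1"
    and crit: "\<And>j. j < N \<Longrightarrow> (\<Sum>l<N. 1 / (y j - y l)) - (a + b) / 2 / (1 - y j) + b / 2 / (1 + y j) = 0"
  shows "{x. jacobiP N (a + b - 1) (b - 1) x = 0} = y ` {..<N}"
proof -
  define p where "p = (\<Prod>i<N. [:- y i, 1:])"
  have degp: "degree p = N" unfolding p_def by (simp add: degree_prod_sum_eq)
  have lead: "coeff p N = 1"
    using lead_coeff_prod[of "\<lambda>i. [:- y i, 1:]" "{..<N}"] degp unfolding p_def by simp
  have Lp: "jacobi_op N a b p = 0"
  proof (rule ccontr)
    assume ne: "jacobi_op N a b p \<noteq> 0"
    \<comment> \<open>The diagonal entry at \<open>m = N\<close> is zero, so the image has degree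
      below \<open>N\<close>; it will be shown to vanish at the \<open>N\<close> distinct points
      \<open>y j\<close>.\<close>
    have "coeff (jacobi_op N a b p) m = 0" if "m \<ge> N" for m
      using that degp by (cases "m = N") (simp_all add: coeff_jacobi_op coeff_eq_0)
    with ne have deg: "degree (jacobi_op N a b p) < N"
      by (metis leading_coeff_0_iff not_le)
    have "y ` {..<N} \<subseteq> {x. poly (jacobi_op N a b p) x = 0}"
    proof clarify
      fix j assume j: "j < N"
      have pj: "poly p (y j) = 0" unfolding p_def poly_prod using j by auto
      have n: "1 - y j \<noteq> 0" "1 + y j \<noteq> 0" using y[OF j] by auto
      \<comment> \<open>At a root the term of order zero drops out and \<open>p''\<close> is a
        multiple of \<open>p'\<close>. The remaining factor is
        \<open>2 * (1 - y j) * (1 + y j)\<close> times the left-hand side of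
        \<open>crit\<close>.\<close>
      have "poly (jacobi_op N a b p) (y j) = poly (pderiv p) (y j) *
          (2 * ((1 - y j) * (1 + y j)) * (\<Sum>l<N. 1 / (y j - y l)) - a - (a + 2 * b) * y j)"
        unfolding jacobi_op_def using poly_prod_roots_deriv2[OF inj j, folded p_def] pj
        by (simp add: algebra_simps)
      also have "(\<Sum>l<N. 1 / (y j - y l)) = (a + b) / 2 / (1 - y j) - b / 2 / (1 + y j)"
        using crit[OF j] by linarith
      also have "2 * ((1 - y j) * (1 + y j)) * ((a + b) / 2 / (1 - y j) - b / 2 / (1 + y j)) = a + (a + 2 * b) * y j"
      proof -
        have r: "(1 - y j) * inverse (1 - y j) = 1" "(1 + y j) * inverse (1 + y j) = 1" using n by simp_all
        have "2 * ((1 - y j) * (1 + y j)) * ((a + b) / 2 / (1 - y j) - b / 2 / (1 + y j))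
            = ((1 - y j) * inverse (1 - y j)) * (1 + y j) * (a + b)
              - ((1 + y j) * inverse (1 + y j)) * (1 - y j) * b"
          unfolding divide_inverse by (simp add: algebra_simps add_divide_distrib diff_divide_distrib)
        then show ?thesis unfolding r by (simp add: algebra_simps)
      qed
      finally show "poly (jacobi_op N a b p) (y j) = 0" by simp
    qed
    then have "card (y ` {..<N}) \<le> card {x. poly (jacobi_op N a b p) x = 0}"
      by (rule card_mono[OF poly_roots_finite[OF ne]])
    also have "\<dots> \<le> degree (jacobi_op N a b p)" by (rule card_poly_roots_bound[OF ne])
    finally show False using deg inj by (simp add: card_image)
  qed
  define J where "J = jacobi_poly N (a + b - 1) (b - 1)"
  define c where "c = coeff J N"
  \<comment> \<open>The multiple of the monic \<open>p\<close> is chosen to remove the coefficient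
    of degree \<open>N\<close>, where the diagonal of the operator is zero.\<close>
  have "J - smult c p = 0"
  proof (rule jacobi_op_eq_0_imp)
    show "a + 2 * b > 0" using a b by simp
    show "jacobi_op N a b (J - smult c p) = 0"
      by (simp add: jacobi_op_diff jacobi_op_smult Lp J_def jacobi_op_jacobi_poly)
    show "degree (J - smult c p) \<le> N"
      using degp degree_jacobi_poly by (intro degree_diff_le) (simp_all add: J_def)
    show "coeff (J - smult c p) N = 0" by (simp add: lead c_def)
  qed
  then have J: "J = smult c p" by simp
  moreover have "J \<noteq> 0" unfolding J_def using a b by (intro jacobi_poly_neq_0) simp
  ultimately have "c \<noteq> 0" by auto
  then have "{x. poly J x = 0} = {x. poly p x = 0}" by (simp add: J)
  also have "\<dots> = y ` {..<N}" by (auto simp: p_def poly_prod)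
  finally show ?thesis by (simp add: J_def poly_jacobi_poly)
qed

section \<open>The logarithmic energy\<close>

text \<open>Constrains only the coordinates below \<open>N\<close> and does not ask for
  extensionality, so that it applies directly to lines such as
  \<open>\<lambda>i. y i + t * w i\<close>.\<close>

definition open_simplex :: "nat \<Rightarrow> (nat \<Rightarrow> real) \<Rightarrow> bool" where
  "open_simplex N x \<longleftrightarrow> (\<forall>i<N. -1 < x i \<and> x i < 1) \<and> (\<forall>j<N. \<forall>i<j. x i < x j)"

definition energy :: "nat \<Rightarrow> real \<Rightarrow> real \<Rightarrow> (nat \<Rightarrow> real) \<Rightarrow> real" where
  "energy N a b x = (\<Sum>j<N. \<Sum>i<j. ln (x j - x i))
     + (\<Sum>i<N. (a + b) / 2 * ln (1 - x i) + b / 2 * ln (1 + x i))"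

text \<open>The directional derivative at \<open>x\<close> along \<open>w\<close>, kept as a sum
  over the individual logarithms so that it can later be subtracted term by term.\<close>

definition energy_deriv :: "nat \<Rightarrow> real \<Rightarrow> real \<Rightarrow> (nat \<Rightarrow> real) \<Rightarrow> (nat \<Rightarrow> real) \<Rightarrow> real" where
  "energy_deriv N a b x w = (\<Sum>j<N. \<Sum>i<j. (w j - w i) / (x j - x i))
     + (\<Sum>i<N. (a + b) / 2 * (- w i / (1 - x i)) + b / 2 * (w i / (1 + x i)))"

lemma sum_offdiag_sym:
  fixes F :: "nat \<Rightarrow> nat \<Rightarrow> real"
  assumes "\<And>i k. F i k = F k i" and "\<And>i. F i i = 0"
  shows "(\<Sum>k<N. \<Sum>i<N. F k i) = 2 * (\<Sum>k<N. \<Sum>i<k. F k i)"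
proof (induction N)
  case (Suc N)
  have "(\<Sum>k<N. F k N) = (\<Sum>i<N. F N i)" by (intro sum.cong refl assms(1))
  then show ?case using Suc by (simp add: sum.distrib assms(2))
qed simp

text \<open>Openness of the simplex, stated for filters to serve both for small perturbations of a
  maximizer and for the rescaling with \<open>\<kappa>\<close> tending to infinity.\<close>

lemma eventually_open_simplex:
  assumes y: "open_simplex N y" and lim: "\<And>i. i < N \<Longrightarrow> ((\<lambda>t. x t i) \<longlongrightarrow> y i) F"
  shows "eventually (\<lambda>t. open_simplex N (x t)) F"
proof -
  have 1: "eventually (\<lambda>t. \<forall>i\<in>{..<N}. -1 < x t i \<and> x t i < 1) F"
  proof (intro eventually_ball_finite ballI eventually_conj)
    fix i assume "i \<in> {..<N}"
    then have i: "i < N" by simp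
    show "eventually (\<lambda>t. -1 < x t i) F" "eventually (\<lambda>t. x t i < 1) F"
      using order_tendstoD[OF lim[OF i]] y i by (auto simp: open_simplex_def)
  qed simp
  have 2: "eventually (\<lambda>t. \<forall>j\<in>{..<N}. \<forall>i\<in>{..<j}. 0 < x t j - x t i) F"
  proof (intro eventually_ball_finite ballI)
    fix j i assume "j \<in> {..<N}" "i \<in> {..<j}"
    then have ij: "j < N" "i < N" "i < j" by auto
    have "((\<lambda>t. x t j - x t i) \<longlongrightarrow> y j - y i) F" by (intro tendsto_diff lim ij)
    then show "eventually (\<lambda>t. 0 < x t j - x t i) F"
      using y ij by (intro order_tendstoD(1)) (auto simp: open_simplex_def)
  qed simp_all
  from 1 2 show ?thesis
    by eventually_elim (auto simp: open_simplex_def)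
qed

section \<open>Existence of a maximizer\<close>

lemma exp_energy:
  assumes "open_simplex N x"
  shows "(\<Prod>j<N. \<Prod>i<j. x j - x i) * (\<Prod>i<N. (1 - x i) powr ((a + b) / 2) * (1 + x i) powr (b / 2))
    = exp (energy N a b x)"
proof -
  have x: "0 < 1 - x i" "0 < 1 + x i" if "i < N" for i
    using assms that by (auto simp: open_simplex_def)
  have d: "0 < x j - x i" if "j < N" "i < j" for i j
    using assms that by (auto simp: open_simplex_def)
  have "(\<Prod>j<N. \<Prod>i<j. x j - x i) = exp (\<Sum>j<N. \<Sum>i<j. ln (x j - x i))"
    using d by (simp add: exp_sum)
  moreover have "(1 - x i) powr ((a + b) / 2) * (1 + x i) powr (b / 2)
     = exp ((a + b) / 2 * ln (1 - x i) + b / 2 * ln (1 + x i))" if "i < N" for i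
    using x[OF that] by (simp add: powr_def exp_add)
  ultimately show ?thesis by (simp add: energy_def exp_add exp_sum)
qed

text \<open>The energy tends to minus infinity at the boundary, but its exponential has positive
  exponents and extends continuously by zero to the closed simplex. There compactness gives a
  maximum, and its positive value keeps the maximizer off the boundary.\<close>

lemma energy_maximizer:
  assumes a: "a \<ge> 0" and b: "b > 0"
  shows "\<exists>y. open_simplex N y \<and> (\<forall>x. open_simplex N x \<longrightarrow> energy N a b x \<le> energy N a b y)"
proof -
  define f :: "(nat \<Rightarrow> real) \<Rightarrow> real" where
    "f x = (\<Prod>j<N. \<Prod>i<j. x j - x i) * (\<Prod>i<N. (1 - x i) powr ((a + b) / 2) * (1 + x i) powr (b / 2))" for x
  \<comment> \<open>Pinning the coordinates from \<open>N\<close> on to \<open>0\<close> makes the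
    box compact in the product topology on all functions.\<close>
  define B :: "(nat \<Rightarrow> real) set" where "B = PiE UNIV (\<lambda>i. if i < N then {-1..1} else {0})"
  define K where "K = B \<inter> {x. \<forall>i j. i < j \<longrightarrow> j < N \<longrightarrow> x i \<le> x j}"
  have cont [continuous_intros]: "continuous_on S (\<lambda>x::nat \<Rightarrow> real. x i)" for S i
    by (rule continuous_on_subset[OF continuous_on_product_coordinates]) simp
  have "compactin (product_topology (\<lambda>_. euclidean) UNIV) B"
    unfolding B_def by (subst compactin_PiE) auto
  then have "compact B" by (simp add: euclidean_product_topology)
  moreover have "closed {x::nat \<Rightarrow> real. \<forall>i j. i < j \<longrightarrow> j < N \<longrightarrow> x i \<le> x j}"
    by (intro closed_Collect_all closed_Collect_imp closed_Collect_le cont) auto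
  ultimately have "compact K" unfolding K_def by (rule compact_Int_closed)
  have BD: "-1 \<le> x i" "x i \<le> 1" if "x \<in> K" "i < N" for x i
    using that by (auto simp: K_def B_def PiE_iff split: if_splits)
  have ord: "x i \<le> x j" if "x \<in> K" "i < j" "j < N" for x i j
    using that by (auto simp: K_def)
  have restr: "(\<lambda>i. if i < N then x i else 0) \<in> K" if "open_simplex N x" for x
    using that by (auto simp: K_def B_def open_simplex_def less_imp_le)
  have fr: "f (\<lambda>i. if i < N then x i else 0) = f x" for x
    unfolding f_def by (intro arg_cong2[of _ _ _ _ "(*)"] prod.cong) auto
  \<comment> \<open>Equally spaced interior points, a witness that the maximum is positive.\<close>
  define x0 where "x0 i = -1 + 2 * (real i + 1) / (real N + 1)" for i
  have x0: "open_simplex N x0"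
    unfolding open_simplex_def x0_def
    by (auto intro!: divide_strict_right_mono) (auto simp: field_simps)
  have "continuous_on K f"
    unfolding f_def using a b
    by (intro continuous_intros continuous_on_powr') (auto dest: BD)
  then obtain y where y: "y \<in> K" "\<And>x. x \<in> K \<Longrightarrow> f x \<le> f y"
    using continuous_attains_sup[OF \<open>compact K\<close>, of f] restr[OF x0] by blast
  have ge: "f x \<le> f y" if "open_simplex N x" for x
    using y(2)[OF restr[OF that]] by (simp add: fr)
  have pos: "f x = exp (energy N a b x)" if "open_simplex N x" for x
    unfolding f_def by (rule exp_energy[OF that])
  have "f y > 0" using ge[OF x0] pos[OF x0] by (smt (verit) exp_gt_zero)
  then have nz: "f y \<noteq> 0" by simp
  have oy: "open_simplex N y"
    unfolding open_simplex_def
  proof (intro conjI allI impI)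
    fix i assume i: "i < N"
    have "(1 - y i) powr ((a + b) / 2) * (1 + y i) powr (b / 2) \<noteq> 0"
      using nz i by (auto simp: f_def)
    then show "-1 < y i" "y i < 1" using BD[OF y(1) i] by (auto simp: less_le)
  next
    fix j i assume ij: "j < N" "i < j"
    then have "y j - y i \<noteq> 0" using nz by (auto simp: f_def)
    then show "y i < y j" using ord[OF y(1) ij(2,1)] by auto
  qed
  have "energy N a b x \<le> energy N a b y" if "open_simplex N x" for x
    using ge[OF that] by (simp add: pos that oy)
  then show ?thesis using oy by blast
qed

section \<open>First-order conditions\<close>

lemma energy_has_derivative:
  assumes y: "open_simplex N y"
  shows "((\<lambda>t. energy N a b (\<lambda>i. y i + t * w i)) has_real_derivative energy_deriv N a b y w) (at 0)"
proof -
  have x: "0 < 1 - y i" "0 < 1 + y i" if "i < N" for i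
    using y that by (auto simp: open_simplex_def)
  have d: "0 < y j - y i" if "j < N" "i < j" for i j
    using y that by (auto simp: open_simplex_def)
  have D: "((\<lambda>t. ln (p + t * q)) has_real_derivative q / p) (at 0)" if "p > 0" for p q :: real
    using that by (auto intro!: derivative_eq_intros)
  have "energy N a b (\<lambda>i. y i + t * w i) = (\<Sum>j<N. \<Sum>i<j. ln ((y j - y i) + t * (w j - w i)))
     + (\<Sum>i<N. (a + b) / 2 * ln ((1 - y i) + t * (- w i)) + b / 2 * ln ((1 + y i) + t * w i))" for t
    by (simp add: energy_def algebra_simps)
  then show ?thesis
    unfolding energy_deriv_def by (simp only:) (intro DERIV_add DERIV_sum DERIV_cmult D x d; simp)
qed

lemma energy_deriv_maximizer:
  assumes y: "open_simplex N y"
    and max: "\<And>x. open_simplex N x \<Longrightarrow> energy N a b x \<le> energy N a b y"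
  shows "energy_deriv N a b y w = 0"
proof -
  have "eventually (\<lambda>t. open_simplex N (\<lambda>i. y i + t * w i)) (nhds (0::real))"
    by (rule eventually_open_simplex[OF y]) (auto intro!: tendsto_eq_intros filterlim_ident)
  then obtain e where e: "e > 0" "\<And>t. dist t 0 < e \<Longrightarrow> open_simplex N (\<lambda>i. y i + t * w i)"
    unfolding eventually_nhds_metric by blast
  show ?thesis
  proof (rule DERIV_local_max[OF energy_has_derivative[OF y] e(1)])
    show "\<forall>t. \<bar>0 - t\<bar> < e \<longrightarrow> energy N a b (\<lambda>i. y i + t * w i) \<le> energy N a b (\<lambda>i. y i + 0 * w i)"
      using e(2) max by (auto simp: dist_real_def)
  qed
qed

text \<open>Turns criticality along a unit vector into the equation \<open>crit\<close> of
  \<open>jacobiP_zeros\<close>.\<close>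

lemma energy_deriv_coordinate:
  assumes j: "j < N"
  shows "energy_deriv N a b y (\<lambda>i. if i = j then 1 else 0)
    = (\<Sum>l<N. 1 / (y j - y l)) - (a + b) / 2 / (1 - y j) + b / 2 / (1 + y j)"
proof -
  define w :: "nat \<Rightarrow> real" where "w i = (if i = j then 1 else 0)" for i
  define F where "F k i = (w k - w i) / (y k - y i)" for k i
  \<comment> \<open>\<open>F\<close> is symmetric with zero diagonal, so the sum over pairs is half
    of the full double sum; antisymmetry of \<open>1 / (y k - y i)\<close> then merges its two
    halves.\<close>
  have "2 * (\<Sum>k<N. \<Sum>i<k. F k i) = (\<Sum>k<N. \<Sum>i<N. F k i)"
  proof (rule sum_offdiag_sym[symmetric])
    show "F i k = F k i" for i k
      unfolding F_def by (metis minus_diff_eq minus_divide_divide)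
  qed (simp add: F_def)
  also have "\<dots> = (\<Sum>k<N. w k * (\<Sum>i<N. 1 / (y k - y i))) - (\<Sum>k<N. \<Sum>i<N. w i * (1 / (y k - y i)))"
    by (simp add: F_def diff_divide_distrib sum_subtractf sum_distrib_left)
  also have "(\<Sum>k<N. \<Sum>i<N. w i * (1 / (y k - y i))) = (\<Sum>i<N. w i * (\<Sum>k<N. 1 / (y k - y i)))"
    by (subst sum.swap) (simp add: sum_distrib_left)
  also have "\<dots> = - (\<Sum>i<N. w i * (\<Sum>k<N. 1 / (y i - y k)))"
  proof -
    have "(\<Sum>k<N. 1 / (y k - y i)) = - (\<Sum>k<N. 1 / (y i - y k))" for i
      unfolding sum_negf[symmetric] by (intro sum.cong refl) (metis minus_diff_eq minus_divide_right)
    then show ?thesis by (simp add: sum_negf)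
  qed
  finally have "(\<Sum>k<N. \<Sum>i<k. F k i) = (\<Sum>k<N. w k * (\<Sum>i<N. 1 / (y k - y i)))"
    by simp
  also have "\<dots> = (\<Sum>l<N. 1 / (y j - y l))"
  proof -
    have "(\<Sum>k<N. w k * (\<Sum>i<N. 1 / (y k - y i))) = (\<Sum>k<N. if k = j then (\<Sum>i<N. 1 / (y k - y i)) else 0)"
      by (rule sum.cong) (auto simp: w_def)
    then show ?thesis using j by simp
  qed
  finally have 1: "(\<Sum>k<N. \<Sum>i<k. F k i) = (\<Sum>l<N. 1 / (y j - y l))" .
  have "(\<Sum>i<N. (a + b) / 2 * (- w i / (1 - y i)) + b / 2 * (w i / (1 + y i)))
     = (\<Sum>i<N. if i = j then - ((a + b) / 2 / (1 - y j)) + b / 2 / (1 + y j) else 0)"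
    by (rule sum.cong) (auto simp: w_def)
  also have "\<dots> = - ((a + b) / 2 / (1 - y j)) + b / 2 / (1 + y j)" using j by simp
  finally have 2: "(\<Sum>i<N. (a + b) / 2 * (- w i / (1 - y i)) + b / 2 * (w i / (1 + y i)))
     = - ((a + b) / 2 / (1 - y j)) + b / 2 / (1 + y j)" .
  show ?thesis
    using 1 2 unfolding energy_deriv_def w_def[symmetric] F_def by simp
qed

text \<open>The coordinates of the maximizer \<open>y\<close> form the same set as those of
  \<open>z\<close>. Comparing cardinalities makes \<open>z\<close> injective, and two sorted
  enumerations of one set without repetition agree. Hence \<open>z\<close> inherits the position in
  the simplex and criticality from \<open>y\<close>.\<close>

lemma jacobiP_zeros_critical:
  fixes z :: "nat \<Rightarrow> real"
  assumes a: "a \<ge> 0" and b: "b > 0"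
    and z_sorted: "\<And>i j. i \<le> j \<Longrightarrow> j < N \<Longrightarrow> z i \<le> z j"
    and z_zeros: "z ` {..<N} = {x. jacobiP N (a + b - 1) (b - 1) x = 0}"
  shows "open_simplex N z" and "energy_deriv N a b z w = 0"
proof -
  obtain y where y: "open_simplex N y"
    and max: "\<And>x. open_simplex N x \<Longrightarrow> energy N a b x \<le> energy N a b y"
    using energy_maximizer[OF a b] by blast
  have mono: "y i < y j" if "i < j" "j < N" for i j using y that by (auto simp: open_simplex_def)
  have inj: "inj_on y {..<N}"
    by (rule linorder_inj_onI) (use mono in force)+
  have eq: "z ` {..<N} = y ` {..<N}"
    unfolding z_zeros
  proof (rule jacobiP_zeros[OF a b inj])
    show "\<bar>y j\<bar> < 1" if "j < N" for j using y that by (auto simp: open_simplex_def abs_if)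
    show "(\<Sum>l<N. 1 / (y j - y l)) - (a + b) / 2 / (1 - y j) + b / 2 / (1 + y j) = 0" if "j < N" for j
      using energy_deriv_coordinate[OF that, of a b y] energy_deriv_maximizer[OF y max] by simp
  qed
  have "card (z ` {..<N}) = card {..<N}" unfolding eq using inj by (rule card_image)
  then have injz: "inj_on z {..<N}" by (simp add: inj_on_iff_eq_card)
  have "map z [0..<N] = map y [0..<N]"
  proof (rule sorted_distinct_set_unique)
    show "sorted (map z [0..<N])" using z_sorted by (auto simp: sorted_iff_nth_mono)
    show "sorted (map y [0..<N])" using mono by (auto simp: sorted_iff_nth_mono_less less_imp_le)
  qed (use eq inj injz in \<open>auto simp: distinct_map atLeast0LessThan\<close>)
  then have zy: "z i = y i" if "i < N" for i using that by (simp add: map_eq_conv)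
  show "open_simplex N z" using y zy by (auto simp: open_simplex_def)
  have "energy_deriv N a b z w = energy_deriv N a b y w"
    unfolding energy_deriv_def by (intro arg_cong2[of _ _ _ _ "(+)"] sum.cong) (auto simp: zy)
  then show "energy_deriv N a b z w = 0" using energy_deriv_maximizer[OF y max] by simp
qed

section \<open>Laplace asymptotics\<close>

text \<open>Continuity refers to the product topology on all functions, measurability to the finite
  product measure. The two are reconciled because on extensional functions every coordinate from
  \<open>N\<close> on is the constant \<open>undefined\<close>.\<close>

lemma borel_measurable_RN_continuous_on:
  fixes g :: "(nat \<Rightarrow> real) \<Rightarrow> real"
  assumes "continuous_on (PiE {..<N} (\<lambda>_. UNIV)) g"
  shows "g \<in> borel_measurable (RN N)"
proof -
  let ?A = "PiE {..<N} (\<lambda>_. UNIV :: real set)"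
  have "g \<in> borel_measurable (restrict_space borel ?A)"
    by (rule borel_measurable_continuous_on_restrict) fact
  moreover have "(\<lambda>x. x) \<in> measurable (RN N) (restrict_space borel ?A)"
  proof (rule measurable_restrict_space2)
    show "(\<lambda>x. x) \<in> space (RN N) \<rightarrow> ?A" by (auto simp: space_RN)
    show "(\<lambda>x. x) \<in> borel_measurable (RN N)"
    proof (rule measurable_coordinatewise_then_product)
      fix i :: nat
      show "(\<lambda>x. x i) \<in> borel_measurable (RN N)"
      proof (cases "i < N")
        case False
        then have "x i = undefined" if "x \<in> space (RN N)" for x
          using that by (auto simp: space_RN PiE_def extensional_def)
        then show ?thesis
          by (subst measurable_cong[where g = "\<lambda>_. undefined"]) auto
      qed measurable
    qed
  qed
  ultimately show ?thesis
    using measurable_comp[of "\<lambda>x. x" "RN N" _ g borel] by (simp add: comp_def)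
qed

definition affine_RN :: "nat \<Rightarrow> (nat \<Rightarrow> real) \<Rightarrow> real \<Rightarrow> (nat \<Rightarrow> real) \<Rightarrow> nat \<Rightarrow> real" where
  "affine_RN N m c y = (\<lambda>i\<in>{..<N}. m i + c * y i)"

lemma measurable_affine_RN [measurable]: "affine_RN N m c \<in> measurable (RN N) (RN N)"
proof -
  have "(\<lambda>y. \<lambda>i\<in>{..<N}. m i + c * y i) \<in> measurable (RN N) (PiM {..<N} (\<lambda>_. lborel))"
    by (rule measurable_restrict) simp
  then show ?thesis by (simp add: affine_RN_def[abs_def] RN_def)
qed

text \<open>Boxes determine the product measure and their preimages are again boxes, so the
  one-dimensional substitution contributes a factor \<open>c\<close> per coordinate.\<close>

lemma RN_affine:
  assumes c: "c > 0"
  shows "RN N = density (distr (RN N) (RN N) (affine_RN N m c)) (\<lambda>_. ennreal (c ^ N))" (is "_ = ?P")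
proof -
  interpret product_sigma_finite "\<lambda>_::nat. lborel :: real measure" ..
  have "?P = PiM {..<N} (\<lambda>_. lborel)"
  proof (rule PiM_eqI)
    fix E :: "nat \<Rightarrow> real set" assume E: "\<And>i. i \<in> {..<N} \<Longrightarrow> E i \<in> sets lborel"
    let ?E' = "\<lambda>i. (\<lambda>t. m i + c * t) -` E i"
    have E': "?E' i \<in> sets lborel" if "i < N" for i
      using measurable_sets[of "\<lambda>t. m i + c * t" borel borel "E i"] E that by simp
    have PE: "PiE {..<N} E \<in> sets (RN N)" "PiE {..<N} ?E' \<in> sets (RN N)"
      unfolding RN_def using E E' by (auto intro!: sets_PiM_I_finite)
    have "affine_RN N m c -` PiE {..<N} E \<inter> space (RN N) = PiE {..<N} ?E'"
      by (auto simp: space_RN affine_RN_def PiE_iff)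
    then have "emeasure ?P (PiE {..<N} E) = ennreal (c ^ N) * emeasure (RN N) (PiE {..<N} ?E')"
      using PE by (simp add: emeasure_density_const emeasure_distr)
    also have "emeasure (RN N) (PiE {..<N} ?E') = (\<Prod>i<N. emeasure lborel (?E' i))"
      unfolding RN_def using E' by (intro emeasure_PiM) auto
    also have "ennreal (c ^ N) * \<dots> = (\<Prod>i<N. ennreal c * emeasure lborel (?E' i))"
      using c by (simp add: prod.distrib ennreal_power)
    also have "\<dots> = (\<Prod>i<N. emeasure lborel (E i))"
    proof (rule prod.cong[OF refl])
      fix i assume i: "i \<in> {..<N}"
      show "ennreal c * emeasure lborel (?E' i) = emeasure lborel (E i)"
        using c E[OF i] E'[of i] i
        by (subst (2) lborel_real_affine[of c "m i"]) (simp_all add: emeasure_density_const emeasure_distr)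
    qed
    finally show "emeasure ?P (PiE {..<N} E) = (\<Prod>i<N. emeasure lborel (E i))" .
  qed (simp_all add: RN_def)
  then show ?thesis by (simp add: RN_def)
qed

lemma integral_RN_affine:
  fixes f :: "(nat \<Rightarrow> real) \<Rightarrow> real"
  assumes c: "c > 0" and f [measurable]: "f \<in> borel_measurable (RN N)"
  shows "(\<integral>x. f x \<partial>RN N) = c ^ N * (\<integral>y. f (affine_RN N m c y) \<partial>RN N)"
  using c by (subst RN_affine[OF c, of N m]) (simp add: integral_real_density integral_distr)

section \<open>The density in exponential form\<close>

definition log_edge :: "nat \<Rightarrow> (nat \<Rightarrow> real) \<Rightarrow> real" where
  "log_edge N x = (\<Sum>i<N. - (1/2) * ln (1 - x i) - 1/2 * ln (1 + x i))"

text \<open>Holds at every point, not merely almost everywhere: on the boundary some factor is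
  \<open>0 powr r\<close>, which is \<open>0\<close> for every real \<open>r\<close>, including the
  negative exponents that occur for small \<open>\<kappa>\<close>.\<close>

lemma jacobi_weight_eq:
  assumes x: "x \<in> space (RN N)"
  shows "jacobi_weight N a b \<kappa> x =
    (if open_simplex N x then exp (\<kappa> * energy N a b x + log_edge N x) else 0)"
proof (cases "open_simplex N x")
  case True
  have p: "0 < 1 - x i" "0 < 1 + x i" if "i < N" for i
    using True that by (auto simp: open_simplex_def)
  have d: "0 < x j - x i" if "j < N" "i < j" for i j
    using True that by (auto simp: open_simplex_def)
  have "x i \<le> x j" if "i \<le> j" "j < N" for i j
    using d[of j i] that by (cases "i = j") auto
  then have "x \<in> ordered_cube N"
    using x p by (auto simp: ordered_cube_def space_RN less_imp_le) (smt (verit))+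
  then have "jacobi_weight N a b \<kappa> x = (\<Prod>j<N. \<Prod>i<j. exp (\<kappa> * ln (x j - x i)))
     * (\<Prod>i<N. exp ((\<kappa> * (a + b) / 2 - 1/2) * ln (1 - x i) + (\<kappa> * b / 2 - 1/2) * ln (1 + x i)))"
    unfolding jacobi_weight_def using p d
    by (intro arg_cong2[of _ _ _ _ "(*)"] prod.cong)
       (auto simp: powr_def exp_add[symmetric] less_imp_neq[symmetric])
  also have "\<dots> = exp ((\<Sum>j<N. \<Sum>i<j. \<kappa> * ln (x j - x i))
     + (\<Sum>i<N. (\<kappa> * (a + b) / 2 - 1/2) * ln (1 - x i) + (\<kappa> * b / 2 - 1/2) * ln (1 + x i)))"
    by (simp add: exp_sum exp_add)
  also have "\<dots> = exp (\<kappa> * energy N a b x + log_edge N x)"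
    by (simp add: energy_def log_edge_def sum_distrib_left algebra_simps sum.distrib sum_subtractf sum_negf)
  finally show ?thesis using True by simp
next
  case False
  have "jacobi_weight N a b \<kappa> x = 0"
  proof (cases "x \<in> ordered_cube N")
    case cube: True
    consider i where "i < N" "x i = 1 \<or> x i = -1" | i j where "j < N" "i < j" "x i = x j"
      using False cube unfolding open_simplex_def ordered_cube_def
      by (auto simp: not_less) (metis less_imp_le order_antisym)+
    then show ?thesis
    proof cases
      case 1
      then have "(\<Prod>i<N. (1 - x i) powr (\<kappa> * (a + b) / 2 - 1/2) * (1 + x i) powr (\<kappa> * b / 2 - 1/2)) = 0"
        by (intro prod_zero bexI[of _ i]) auto
      then show ?thesis unfolding jacobi_weight_def by simp
    next
      case 2
      then have "(\<Prod>i<j. (x j - x i) powr \<kappa>) = 0" by (auto intro!: bexI[of _ i])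
      then have "(\<Prod>j<N. \<Prod>i<j. (x j - x i) powr \<kappa>) = 0" using 2 by auto
      then show ?thesis unfolding jacobi_weight_def by simp
    qed
  qed (simp add: jacobi_weight_def)
  then show ?thesis using False by simp
qed

lemma open_simplex_measurable [measurable]: "Measurable.pred (RN N) (open_simplex N)"
proof -
  have "open_simplex N = (\<lambda>x. (\<forall>i\<in>{..<N}. -1 < x i \<and> x i < 1) \<and> (\<forall>j\<in>{..<N}. \<forall>i\<in>{..<j}. x i < x j))"
    by (auto simp: open_simplex_def fun_eq_iff)
  moreover have "Measurable.pred (RN N)
      (\<lambda>x. (\<forall>i\<in>{..<N}. -1 < x i \<and> x i < 1) \<and> (\<forall>j\<in>{..<N}. \<forall>i\<in>{..<j}. x i < x j))"
    by (intro pred_intros_logic pred_intros_finite) auto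
  ultimately show ?thesis by simp
qed

lemma borel_measurable_jacobi_weight [measurable]:
  "jacobi_weight N a b \<kappa> \<in> borel_measurable (RN N)"
proof -
  have [measurable]: "energy N a b \<in> borel_measurable (RN N)" "log_edge N \<in> borel_measurable (RN N)"
    unfolding energy_def[abs_def] log_edge_def[abs_def]
    by (auto intro!: borel_measurable_add borel_measurable_sum borel_measurable_diff borel_measurable_times
        borel_measurable_ln measurable_RN_component)
  show ?thesis
    by (subst measurable_cong[OF jacobi_weight_eq]) measurable
qed

section \<open>Quadratic upper bounds for the energy\<close>

text \<open>Applying \<open>ln u \<le> u - 1\<close> to the square root \<open>u\<close> of
  \<open>p / q\<close> leaves the strict gain \<open>(u - 1)^2\<close>. Since
  \<open>p - q = q (u - 1) (u + 1)\<close>, it remains to bound \<open>(q (u + 1))^2\<close> by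
  \<open>2 q (p + q)\<close>, which is at most 16 for arguments below 2.\<close>

lemma ln_diff_quadratic_bound:
  fixes p q :: real
  assumes "0 < p" "p < 2" "0 < q" "q < 2"
  shows "ln p - ln q - (p - q) / q \<le> - (p - q)\<^sup>2 / 16"
proof -
  define u where "u = sqrt (p / q)"
  have u: "u > 0" "u\<^sup>2 = p / q" using assms by (simp_all add: u_def)
  have "ln p - ln q = ln (u\<^sup>2)" using assms by (simp add: u ln_div)
  also have "\<dots> = 2 * ln u" by (simp add: ln_realpow)
  also have "\<dots> \<le> 2 * (u - 1)" using ln_le_minus_one[OF u(1)] by simp
  finally have "ln p - ln q - (p - q) / q \<le> 2 * (u - 1) - (u\<^sup>2 - 1)"
    using assms by (simp add: u diff_divide_distrib)
  also have "\<dots> = - (u - 1)\<^sup>2" by (simp add: power2_eq_square algebra_simps)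
  finally have 1: "ln p - ln q - (p - q) / q \<le> - (u - 1)\<^sup>2" .
  have pq: "p - q = q * ((u - 1) * (u + 1))"
  proof -
    have "q * ((u - 1) * (u + 1)) = q * (u\<^sup>2 - 1)" by (simp add: power2_eq_square algebra_simps)
    then show ?thesis using assms by (simp add: u field_simps)
  qed
  have "(q * (u + 1))\<^sup>2 \<le> q * (q * (2 * (u\<^sup>2 + 1)))"
  proof -
    have "(u + 1)\<^sup>2 \<le> 2 * (u\<^sup>2 + 1)" using zero_le_power2[of "u - 1"] by (simp add: power2_eq_square algebra_simps)
    then show ?thesis using assms by (simp add: power_mult_distrib power2_eq_square[of q])
  qed
  also have "q * (2 * (u\<^sup>2 + 1)) = 2 * (p + q)" using assms by (simp add: u field_simps)
  also have "q * (2 * (p + q)) \<le> 2 * 8" using assms by (intro mult_mono) auto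
  finally have 2: "(q * (u + 1))\<^sup>2 \<le> 16" by simp
  have "(p - q)\<^sup>2 = (u - 1)\<^sup>2 * (q * (u + 1))\<^sup>2" unfolding pq by (simp add: power_mult_distrib mult_ac)
  also have "\<dots> \<le> (u - 1)\<^sup>2 * 16" using 2 by (intro mult_left_mono) auto
  finally show ?thesis using 1 by simp
qed

text \<open>Subtracting the vanishing derivative gives each logarithm its own tangent, so that both
  the limit and the domination can be read off term by term.\<close>

lemma energy_diff_critical:
  assumes "energy_deriv N a b z (\<lambda>i. x i - z i) = 0"
  shows "energy N a b x - energy N a b z =
     (\<Sum>j<N. \<Sum>i<j. ln (x j - x i) - ln (z j - z i) - ((x j - x i) - (z j - z i)) / (z j - z i))
   + (\<Sum>i<N. (a + b) / 2 * (ln (1 - x i) - ln (1 - z i) - ((1 - x i) - (1 - z i)) / (1 - z i))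
      + b / 2 * (ln (1 + x i) - ln (1 + z i) - ((1 + x i) - (1 + z i)) / (1 + z i)))"
proof -
  have "energy N a b x - energy N a b z = energy N a b x - energy N a b z - energy_deriv N a b z (\<lambda>i. x i - z i)"
    using assms by simp
  also have "\<dots> = (\<Sum>j<N. \<Sum>i<j. ln (x j - x i) - ln (z j - z i) - ((x j - z j) - (x i - z i)) / (z j - z i))
   + (\<Sum>i<N. (a + b) / 2 * (ln (1 - x i) - ln (1 - z i) - (- (x i - z i)) / (1 - z i))
      + b / 2 * (ln (1 + x i) - ln (1 + z i) - (x i - z i) / (1 + z i)))"
    unfolding energy_def energy_deriv_def sum_subtractf right_diff_distrib sum.distrib
    by (simp add: sum_subtractf)
  also have "\<dots> = (\<Sum>j<N. \<Sum>i<j. ln (x j - x i) - ln (z j - z i) - ((x j - x i) - (z j - z i)) / (z j - z i))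
   + (\<Sum>i<N. (a + b) / 2 * (ln (1 - x i) - ln (1 - z i) - ((1 - x i) - (1 - z i)) / (1 - z i))
      + b / 2 * (ln (1 + x i) - ln (1 + z i) - ((1 + x i) - (1 + z i)) / (1 + z i)))"
  proof -
    have e: "(x j - z j) - (x i - z i) = (x j - x i) - (z j - z i)" for i j by simp
    show ?thesis unfolding e by simp
  qed
  finally show ?thesis .
qed

text \<open>By concavity every gap is nonpositive. The gaps of the arguments \<open>1 + x i\<close>,
  which carry the positive weight \<open>b / 2\<close>, already yield the quadratic bound; the
  constant is \<open>(b / 2) / 16\<close>.\<close>

lemma energy_diff_bound:
  assumes a: "a \<ge> 0" and b: "b > 0" and z: "open_simplex N z" and x: "open_simplex N x"
    and crit: "energy_deriv N a b z (\<lambda>i. x i - z i) = 0"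
  shows "energy N a b x - energy N a b z \<le> - (b / 32) * (\<Sum>i<N. (x i - z i)\<^sup>2)"
proof -
  have neg: "ln p - ln q - (p - q) / q \<le> 0" if "p > 0" "q > 0" for p q :: real
    using ln_diff_le[OF that] by simp
  have p: "0 < 1 - x i" "0 < 1 + x i" "0 < 1 - z i" "0 < 1 + z i" "1 + x i < 2" "1 + z i < 2" if "i < N" for i
    using x z that by (auto simp: open_simplex_def)
  have d: "0 < x j - x i" "0 < z j - z i" if "j < N" "i < j" for i j
    using x z that by (auto simp: open_simplex_def)
  have "energy N a b x - energy N a b z \<le> 0 + (\<Sum>i<N. 0 + b / 2 * (- ((1 + x i) - (1 + z i))\<^sup>2 / 16))"
    unfolding energy_diff_critical[OF crit]
  proof (intro add_mono sum_nonpos sum_mono)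
    fix i assume "i \<in> {..<N}"
    then have i: "i < N" by simp
    show "(a + b) / 2 * (ln (1 - x i) - ln (1 - z i) - ((1 - x i) - (1 - z i)) / (1 - z i)) \<le> 0"
      using a b neg[of "1 - x i" "1 - z i"] p[OF i] by (intro mult_nonneg_nonpos) auto
    show "b / 2 * (ln (1 + x i) - ln (1 + z i) - ((1 + x i) - (1 + z i)) / (1 + z i))
        \<le> b / 2 * (- ((1 + x i) - (1 + z i))\<^sup>2 / 16)"
      using b ln_diff_quadratic_bound[of "1 + x i" "1 + z i"] p[OF i] by (intro mult_left_mono) auto
  next
    fix j i assume "j \<in> {..<N}" "i \<in> {..<j}"
    then show "ln (x j - x i) - ln (z j - z i) - ((x j - x i) - (z j - z i)) / (z j - z i) \<le> 0"
      by (intro neg d) auto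
  qed
  also have "\<dots> = - (b / 32) * (\<Sum>i<N. (x i - z i)\<^sup>2)"
    by (simp add: sum_distrib_left)
  finally show ?thesis .
qed

text \<open>The edge singularities (exponent \<open>- 1/2\<close>) are absorbed by the share \<open>1 / b\<close> of \<open>\<kappa>\<close>.\<close>

lemma energy_edge_bound:
  assumes a: "a \<ge> 0" and b: "b > 0" and x: "open_simplex N x"
  shows "energy N a b x / b + log_edge N x \<le> real N * real N / b + real N * (a / (2 * b))"
proof -
  have p: "0 < 1 - x i" "0 < 1 + x i" "1 - x i < 2" if "i < N" for i
    using x that by (auto simp: open_simplex_def)
  have ln1: "ln t \<le> 1" if "0 < t" "t < 2" for t :: real
    using ln_le_minus_one[OF that(1)] that by simp
  have "(\<Sum>j<N. \<Sum>i<j. ln (x j - x i)) \<le> (\<Sum>j<N. \<Sum>i<j. 1)"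
  proof (intro sum_mono ln1)
    fix j i assume "j \<in> {..<N}" "i \<in> {..<j}"
    then have ij: "i < j" "j < N" "i < N" by auto
    show "0 < x j - x i" using x ij by (auto simp: open_simplex_def)
    show "x j - x i < 2" using p[OF ij(2)] p[OF ij(3)] by linarith
  qed
  also have "\<dots> \<le> (\<Sum>j<N. real N)" by (rule sum_mono) simp
  finally have 1: "(\<Sum>j<N. \<Sum>i<j. ln (x j - x i)) \<le> real N * real N" by simp
  have "energy N a b x / b + log_edge N x = (\<Sum>j<N. \<Sum>i<j. ln (x j - x i)) / b + (\<Sum>i<N. a / (2 * b) * ln (1 - x i))"
  proof -
    \<comment> \<open>The share \<open>1 / b\<close> is the smallest that compensates the exponent
      \<open>- 1/2\<close> at the edge \<open>-1\<close>, where the two cancel exactly; at the edge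
      \<open>1\<close> the nonnegative exponent \<open>a / (2 * b)\<close> remains.\<close>
    have "((a + b) / 2 * L + b / 2 * M) / b + (- (1/2) * L - 1/2 * M) = a / (2 * b) * L" for L M
      using b by (simp add: field_simps)
    then show ?thesis
      unfolding energy_def log_edge_def add_divide_distrib[of _ _ b] sum_divide_distrib[of _ "{..<N}"]
        add.assoc sum.distrib[symmetric]
      by (simp add: sum_divide_distrib)
  qed
  also have "\<dots> \<le> real N * real N / b + (\<Sum>i<N. a / (2 * b) * 1)"
    using a b 1 p by (intro add_mono divide_right_mono sum_mono mult_left_mono ln1) auto
  finally show ?thesis by simp
qed

section \<open>The second-order term\<close>

lemma ln_second_order_limit:
  fixes d e :: real
  assumes d: "d > 0"
  shows "((\<lambda>\<kappa>. \<kappa> * (ln (d + e / sqrt \<kappa>) - ln d - (e / sqrt \<kappa>) / d)) \<longlongrightarrow> - (1/2) * (e / d)\<^sup>2) at_top"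
  using d by (real_asymp simp: power2_eq_square field_simps)

text \<open>Kept verbatim in the form of the theorem's matrix, so that unfolding it closes the final
  goal.\<close>

definition hess :: "nat \<Rightarrow> real \<Rightarrow> real \<Rightarrow> (nat \<Rightarrow> real) \<Rightarrow> nat \<Rightarrow> nat \<Rightarrow> real" where
  "hess N a b z = (\<lambda>i j. if i = j
                   then (\<Sum>l\<in>{..<N} - {j}. 1 / (z j - z l)\<^sup>2)
                        + (a + b) / 2 * (1 / (1 - z j)\<^sup>2) + b / 2 * (1 / (1 + z j)\<^sup>2)
                   else - 1 / (z i - z j)\<^sup>2)"

text \<open>The off-diagonal entries and their row sums form a weighted graph Laplacian with weights
  \<open>1 / (z j - z i)^2\<close>. The resulting sum of squares shows definiteness and matches the
  limits from \<open>ln_second_order_limit\<close> one by one.\<close>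

lemma qform_hess:
  "qform N (hess N a b z) y = (\<Sum>j<N. \<Sum>i<j. ((y j - y i) / (z j - z i))\<^sup>2)
     + (\<Sum>i<N. (a + b) / 2 * (y i / (1 - z i))\<^sup>2 + b / 2 * (y i / (1 + z i))\<^sup>2)"
proof -
  define G where "G j i = 1 / (z j - z i)\<^sup>2" for j i
  define e where "e i = (a + b) / 2 * (1 / (1 - z i)\<^sup>2) + b / 2 * (1 / (1 + z i)\<^sup>2)" for i
  have G: "G i j = G j i" "G i i = 0" for i j by (simp_all add: G_def power2_commute)
  have row: "(\<Sum>j<N. y i * hess N a b z i j * y j)
      = (\<Sum>j<N. y i * y i * G i j - y i * y j * G i j) + y i * y i * e i" if i: "i < N" for i
  proof -
    have "(\<Sum>l\<in>{..<N} - {i}. G i l) = (\<Sum>l<N. G i l)"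
      using i by (subst (2) sum.remove[of _ i]) (auto simp: G)
    then have h: "hess N a b z i j = (if j = i then (\<Sum>l<N. G i l) + e i else 0) - G i j" for j
      by (simp add: hess_def G(2)) (auto simp: G_def e_def)
    have "(\<Sum>j<N. y i * hess N a b z i j * y j)
       = (\<Sum>j<N. (if j = i then y i * y i * ((\<Sum>l<N. G i l) + e i) else 0) - y i * y j * G i j)"
      unfolding h by (intro sum.cong) (auto simp: algebra_simps)
    also have "\<dots> = y i * y i * ((\<Sum>l<N. G i l) + e i) - (\<Sum>j<N. y i * y j * G i j)"
      using i by (simp add: sum_subtractf)
    also have "\<dots> = (\<Sum>j<N. y i * y i * G i j - y i * y j * G i j) + y i * y i * e i"
      by (simp add: sum_subtractf sum_distrib_left algebra_simps)
    finally show ?thesis .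
  qed
  have "qform N (hess N a b z) y = (\<Sum>i<N. \<Sum>j<N. y i * y i * G i j - y i * y j * G i j) + (\<Sum>i<N. y i * y i * e i)"
    unfolding qform_def using row by (simp add: sum.distrib)
  also have "(\<Sum>i<N. \<Sum>j<N. y i * y i * G i j - y i * y j * G i j) = (\<Sum>j<N. \<Sum>i<j. (y j - y i)\<^sup>2 * G j i)"
  proof -
    have "2 * (\<Sum>j<N. \<Sum>i<j. (y j - y i)\<^sup>2 * G j i) = (\<Sum>j<N. \<Sum>i<N. (y j - y i)\<^sup>2 * G j i)"
      by (rule sum_offdiag_sym[symmetric]) (auto simp: G power2_commute)
    also have "\<dots> = (\<Sum>j<N. \<Sum>i<N. (y j * y j * G j i - y j * y i * G j i)) + (\<Sum>j<N. \<Sum>i<N. (y i * y i * G j i - y j * y i * G j i))"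
      unfolding sum.distrib[symmetric] by (intro sum.cong refl) (simp add: power2_eq_square algebra_simps)
    also have "(\<Sum>j<N. \<Sum>i<N. (y i * y i * G j i - y j * y i * G j i)) = (\<Sum>j<N. \<Sum>i<N. (y j * y j * G j i - y j * y i * G j i))"
      by (subst sum.swap) (simp add: G(1) mult_ac)
    finally show ?thesis by simp
  qed
  also have "(\<Sum>i<N. y i * y i * e i) = (\<Sum>i<N. (a + b) / 2 * (y i / (1 - z i))\<^sup>2 + b / 2 * (y i / (1 + z i))\<^sup>2)"
    by (intro sum.cong) (simp_all add: e_def power_divide power2_eq_square algebra_simps)
  finally show ?thesis by (simp add: G_def power_divide)
qed

lemma posdef_hess:
  assumes a: "a \<ge> 0" and b: "b > 0" and z: "open_simplex N z"
  shows "posdef N (hess N a b z)"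
  unfolding posdef_def
proof safe
  fix i j show "hess N a b z i j = hess N a b z j i" by (simp add: hess_def power2_commute)
next
  fix y :: "nat \<Rightarrow> real" and i assume i: "i < N" "y i \<noteq> 0"
  have "0 < 1 + z i" using z i by (auto simp: open_simplex_def)
  then have "0 < b / 2 * (y i / (1 + z i))\<^sup>2" using b i by simp
  also have "\<dots> \<le> (a + b) / 2 * (y i / (1 - z i))\<^sup>2 + b / 2 * (y i / (1 + z i))\<^sup>2" using a b by simp
  also have "\<dots> \<le> (\<Sum>i<N. (a + b) / 2 * (y i / (1 - z i))\<^sup>2 + b / 2 * (y i / (1 + z i))\<^sup>2)"
    using i a b by (intro member_le_sum) auto
  also have "\<dots> \<le> qform N (hess N a b z) y"
    unfolding qform_hess by (simp add: sum_nonneg)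
  finally show "0 < qform N (hess N a b z) y" .
qed

text \<open>The density of \<open>sqrt \<kappa> * (X - z)\<close> up to a factor independent of \<open>y\<close>.\<close>

definition scaled_weight :: "nat \<Rightarrow> real \<Rightarrow> real \<Rightarrow> (nat \<Rightarrow> real) \<Rightarrow> real \<Rightarrow> (nat \<Rightarrow> real) \<Rightarrow> real" where
  "scaled_weight N a b z \<kappa> y =
     exp (- \<kappa> * energy N a b z) * jacobi_weight N a b \<kappa> (affine_RN N z (1 / sqrt \<kappa>) y)"

lemma borel_measurable_scaled_weight [measurable]:
  "scaled_weight N a b z \<kappa> \<in> borel_measurable (RN N)"
  unfolding scaled_weight_def[abs_def] by measurable

lemma energy_cong: "(\<And>i. i < N \<Longrightarrow> x i = x' i) \<Longrightarrow> energy N a b x = energy N a b x'"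
  unfolding energy_def by (intro arg_cong2[of _ _ _ _ "(+)"] sum.cong) auto

lemma log_edge_cong: "(\<And>i. i < N \<Longrightarrow> x i = x' i) \<Longrightarrow> log_edge N x = log_edge N x'"
  unfolding log_edge_def by (intro sum.cong) auto

lemma open_simplex_cong: "(\<And>i. i < N \<Longrightarrow> x i = x' i) \<Longrightarrow> open_simplex N x = open_simplex N x'"
  unfolding open_simplex_def by auto

lemma scaled_weight_eq:
  "scaled_weight N a b z \<kappa> y =
     (if open_simplex N (\<lambda>i. z i + y i / sqrt \<kappa>)
      then exp (\<kappa> * (energy N a b (\<lambda>i. z i + y i / sqrt \<kappa>) - energy N a b z)
        + log_edge N (\<lambda>i. z i + y i / sqrt \<kappa>)) else 0)"
proof -
  define x where "x = affine_RN N z (1 / sqrt \<kappa>) y"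
  have x: "x i = z i + y i / sqrt \<kappa>" if "i < N" for i using that by (simp add: x_def affine_RN_def)
  have sp: "x \<in> space (RN N)" by (auto simp: x_def space_RN affine_RN_def)
  have c: "energy N a b x = energy N a b (\<lambda>i. z i + y i / sqrt \<kappa>)"
     "log_edge N x = log_edge N (\<lambda>i. z i + y i / sqrt \<kappa>)"
     "open_simplex N x = open_simplex N (\<lambda>i. z i + y i / sqrt \<kappa>)"
    using x by (auto intro!: energy_cong log_edge_cong open_simplex_cong)
  show ?thesis
    unfolding scaled_weight_def x_def[symmetric] jacobi_weight_eq[OF sp] c
    by (simp add: exp_add[symmetric] algebra_simps)
qed

lemma scaled_weight_nonneg: "scaled_weight N a b z \<kappa> y \<ge> 0"
  by (simp add: scaled_weight_eq)

section \<open>Pointwise limit and domination\<close>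

lemma scaled_weight_tendsto:
  assumes z: "open_simplex N z" and crit: "\<And>w. energy_deriv N a b z w = 0"
  shows "((\<lambda>\<kappa>. scaled_weight N a b z \<kappa> y) \<longlongrightarrow>
     exp (- (1/2) * qform N (hess N a b z) y + log_edge N z)) at_top"
proof -
  have x_lim: "((\<lambda>\<kappa>. z i + y i / sqrt \<kappa>) \<longlongrightarrow> z i) at_top" for i
    by real_asymp
  have ev: "eventually (\<lambda>\<kappa>. open_simplex N (\<lambda>i. z i + y i / sqrt \<kappa>)) at_top"
    by (rule eventually_open_simplex[OF z x_lim])
  have p: "0 < 1 - z i" "0 < 1 + z i" if "i < N" for i
    using z that by (auto simp: open_simplex_def)
  have d: "0 < z j - z i" if "j < N" "i < j" for i j
    using z that by (auto simp: open_simplex_def)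
  have edge: "((\<lambda>\<kappa>. log_edge N (\<lambda>i. z i + y i / sqrt \<kappa>)) \<longlongrightarrow> log_edge N z) at_top"
    unfolding log_edge_def using p
    by (intro tendsto_intros x_lim) (auto simp: less_imp_neq[symmetric])
  have "((\<lambda>\<kappa>. (\<Sum>j<N. \<Sum>i<j. \<kappa> * (ln ((z j - z i) + (y j - y i) / sqrt \<kappa>) - ln (z j - z i) - ((y j - y i) / sqrt \<kappa>) / (z j - z i)))
      + (\<Sum>i<N. (a + b) / 2 * (\<kappa> * (ln ((1 - z i) + (- y i) / sqrt \<kappa>) - ln (1 - z i) - ((- y i) / sqrt \<kappa>) / (1 - z i)))
        + b / 2 * (\<kappa> * (ln ((1 + z i) + y i / sqrt \<kappa>) - ln (1 + z i) - (y i / sqrt \<kappa>) / (1 + z i)))))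
     \<longlongrightarrow> (\<Sum>j<N. \<Sum>i<j. - (1/2) * ((y j - y i) / (z j - z i))\<^sup>2)
       + (\<Sum>i<N. (a + b) / 2 * (- (1/2) * ((- y i) / (1 - z i))\<^sup>2) + b / 2 * (- (1/2) * (y i / (1 + z i))\<^sup>2))) at_top"
    by (intro tendsto_add tendsto_sum tendsto_mult_left ln_second_order_limit p d) simp_all
  moreover have "(\<Sum>j<N. \<Sum>i<j. - (1/2) * ((y j - y i) / (z j - z i))\<^sup>2)
       + (\<Sum>i<N. (a + b) / 2 * (- (1/2) * ((- y i) / (1 - z i))\<^sup>2) + b / 2 * (- (1/2) * (y i / (1 + z i))\<^sup>2))
     = - (1/2) * qform N (hess N a b z) y"
    unfolding qform_hess distrib_left sum_distrib_left by (simp add: power_divide)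
  moreover have "(\<Sum>j<N. \<Sum>i<j. \<kappa> * (ln ((z j - z i) + (y j - y i) / sqrt \<kappa>) - ln (z j - z i) - ((y j - y i) / sqrt \<kappa>) / (z j - z i)))
      + (\<Sum>i<N. (a + b) / 2 * (\<kappa> * (ln ((1 - z i) + (- y i) / sqrt \<kappa>) - ln (1 - z i) - ((- y i) / sqrt \<kappa>) / (1 - z i)))
        + b / 2 * (\<kappa> * (ln ((1 + z i) + y i / sqrt \<kappa>) - ln (1 + z i) - (y i / sqrt \<kappa>) / (1 + z i))))
     = \<kappa> * (energy N a b (\<lambda>i. z i + y i / sqrt \<kappa>) - energy N a b z)" for \<kappa>
  proof -
    have e: "z j + y j / sqrt \<kappa> - (z i + y i / sqrt \<kappa>) = (z j - z i) + (y j - y i) / sqrt \<kappa>"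
      "1 - (z i + y i / sqrt \<kappa>) = (1 - z i) + (- y i) / sqrt \<kappa>"
      "1 + (z i + y i / sqrt \<kappa>) = (1 + z i) + y i / sqrt \<kappa>" for i j
      by (simp_all add: diff_divide_distrib)
    show ?thesis
      unfolding energy_diff_critical[OF crit] e distrib_left sum_distrib_left
      by (simp add: mult.left_commute)
  qed
  ultimately have "((\<lambda>\<kappa>. \<kappa> * (energy N a b (\<lambda>i. z i + y i / sqrt \<kappa>) - energy N a b z))
      \<longlongrightarrow> - (1/2) * qform N (hess N a b z) y) at_top" by simp
  from tendsto_exp[OF tendsto_add[OF this edge]] show ?thesis
    by (rule Lim_transform_eventually) (use ev in \<open>eventually_elim, simp add: scaled_weight_eq\<close>)
qed

text \<open>Split \<open>\<kappa>\<close> into \<open>\<kappa> - 1 / b\<close> and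
  \<open>1 / b\<close>. The second share pays for the edge singularities through
  \<open>energy_edge_bound\<close>. For \<open>\<kappa> \<ge> 2 / b\<close> the first is at least
  \<open>\<kappa> / 2\<close>, which halves the rate \<open>b / 32\<close> of
  \<open>energy_diff_bound\<close>. Outside the simplex the weight is zero.\<close>

lemma scaled_weight_bound:
  assumes a: "a \<ge> 0" and b: "b > 0" and z: "open_simplex N z"
    and crit: "\<And>w. energy_deriv N a b z w = 0"
  shows "\<exists>C. \<forall>\<kappa>\<ge>2 / b. \<forall>y. scaled_weight N a b z \<kappa> y \<le> C * (\<Prod>i<N. exp (- (b / 64) * (y i)\<^sup>2))"
proof -
  define C where "C = real N * real N / b + real N * (a / (2 * b)) - energy N a b z / b"
  have "scaled_weight N a b z \<kappa> y \<le> exp C * (\<Prod>i<N. exp (- (b / 64) * (y i)\<^sup>2))" if \<kappa>: "\<kappa> \<ge> 2 / b" for \<kappa> y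
  proof (cases "open_simplex N (\<lambda>i. z i + y i / sqrt \<kappa>)")
    case True
    define x where "x = (\<lambda>i. z i + y i / sqrt \<kappa>)"
    have "2 / b > 0" using b by simp
    then have \<kappa>0: "\<kappa> > 0" using \<kappa> by linarith
    have x: "open_simplex N x" using True by (simp add: x_def)
    define D where "D = (\<Sum>i<N. (y i)\<^sup>2)"
    have "(\<Sum>i<N. (x i - z i)\<^sup>2) = D / \<kappa>"
      using \<kappa>0 by (simp add: x_def D_def power_divide sum_divide_distrib)
    then have en: "energy N a b x - energy N a b z \<le> - (b / 32) * (D / \<kappa>)"
      using energy_diff_bound[OF a b z x crit] by simp
    have "(\<kappa> - 1 / b) * (energy N a b x - energy N a b z) \<le> (\<kappa> - 1 / b) * (- (b / 32) * (D / \<kappa>))"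
      using \<kappa> b en by (intro mult_left_mono) (auto simp: field_simps)
    also have "\<dots> \<le> (\<kappa> / 2) * (- (b / 32) * (D / \<kappa>))"
    proof (rule mult_right_mono_neg)
      show "\<kappa> / 2 \<le> \<kappa> - 1 / b" using \<kappa> b by (simp add: field_simps)
      show "- (b / 32) * (D / \<kappa>) \<le> 0" using b \<kappa>0 by (simp add: D_def sum_nonneg)
    qed
    also have "\<dots> = - (b / 64) * D" using \<kappa>0 by simp
    finally have 1: "(\<kappa> - 1 / b) * (energy N a b x - energy N a b z) \<le> - (b / 64) * D" .
    have "\<kappa> * (energy N a b x - energy N a b z) + log_edge N x
       = (\<kappa> - 1 / b) * (energy N a b x - energy N a b z) + (energy N a b x / b + log_edge N x) - energy N a b z / b"
      by (simp add: algebra_simps diff_divide_distrib)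
    also have "\<dots> \<le> C + (- (b / 64) * D)"
      using 1 energy_edge_bound[OF a b x] by (simp add: C_def)
    finally have "scaled_weight N a b z \<kappa> y \<le> exp (C + (- (b / 64) * D))"
      using True by (simp add: scaled_weight_eq x_def)
    also have "\<dots> = exp C * (\<Prod>i<N. exp (- (b / 64) * (y i)\<^sup>2))"
      unfolding exp_add D_def sum_distrib_left by (simp add: exp_sum)
    finally show ?thesis .
  qed (simp add: scaled_weight_eq prod_nonneg)
  then show ?thesis by blast
qed

lemma integrable_RN_gaussian:
  assumes "c > 0"
  shows "integrable (RN N) (\<lambda>y. \<Prod>i<N. exp (- c * (y i)\<^sup>2))"
proof -
  interpret product_sigma_finite "\<lambda>_::nat. lborel :: real measure" ..
  have "exp (- c * t\<^sup>2) = exp (- (1/2) * ((2 * c) * (t + 0)\<^sup>2))" for t by simp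
  then have "(\<integral>\<^sup>+t. ennreal (exp (- c * t\<^sup>2)) \<partial>lborel) < \<infinity>"
    using nn_integral_gaussian_shift[of "2 * c" 0] assms by (simp only:) simp
  then have "integrable lborel (\<lambda>t. exp (- c * t\<^sup>2))"
    by (intro integrableI_bounded) auto
  then show ?thesis unfolding RN_def by (intro product_integrable_prod) auto
qed

lemma integral_scaled_weight_tendsto:
  assumes a: "a \<ge> 0" and b: "b > 0" and z: "open_simplex N z"
    and crit: "\<And>w. energy_deriv N a b z w = 0"
    and g [measurable]: "g \<in> borel_measurable (RN N)" and bd: "\<And>y. y \<in> space (RN N) \<Longrightarrow> \<bar>g y\<bar> \<le> B"
  shows "((\<lambda>\<kappa>. \<integral>y. g y * scaled_weight N a b z \<kappa> y \<partial>RN N) \<longlongrightarrow>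
     (\<integral>y. g y * exp (- (1/2) * qform N (hess N a b z) y + log_edge N z) \<partial>RN N)) at_top"
proof -
  obtain C where C: "\<And>\<kappa> y. \<kappa> \<ge> 2 / b \<Longrightarrow> scaled_weight N a b z \<kappa> y \<le> C * (\<Prod>i<N. exp (- (b / 64) * (y i)\<^sup>2))"
    using scaled_weight_bound[OF a b z crit] by blast
  show ?thesis
  proof (rule integral_dominated_convergence_at_top[where w = "\<lambda>y. B * (C * (\<Prod>i<N. exp (- (b / 64) * (y i)\<^sup>2)))"])
    show "integrable (RN N) (\<lambda>y. B * (C * (\<Prod>i<N. exp (- (b / 64) * (y i)\<^sup>2))))"
      using b by (intro integrable_mult_right integrable_RN_gaussian) simp
    show "AE y in RN N. ((\<lambda>\<kappa>. g y * scaled_weight N a b z \<kappa> y) \<longlongrightarrow>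
        g y * exp (- (1/2) * qform N (hess N a b z) y + log_edge N z)) at_top"
      by (intro AE_I2 tendsto_mult_left scaled_weight_tendsto z crit)
    show "\<forall>\<^sub>F \<kappa> in at_top. AE y in RN N. norm (g y * scaled_weight N a b z \<kappa> y)
        \<le> B * (C * (\<Prod>i<N. exp (- (b / 64) * (y i)\<^sup>2)))"
      using eventually_ge_at_top[of "2 / b"]
    proof eventually_elim
      case (elim \<kappa>)
      show ?case
      proof (rule AE_I2)
        fix y assume "y \<in> space (RN N)"
        from bd[OF this] C[OF elim, of y] scaled_weight_nonneg[of N a b z \<kappa> y]
        show "norm (g y * scaled_weight N a b z \<kappa> y) \<le> B * (C * (\<Prod>i<N. exp (- (b / 64) * (y i)\<^sup>2)))"
          unfolding real_norm_def abs_mult by (intro mult_mono) auto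
      qed
    qed
  qed measurable
qed

section \<open>Elimination of the normalizing constants\<close>

text \<open>Rewrites the normal law as a quotient of two integrals in terms of \<open>S\<close>, the
  shape that the laws for finite \<open>\<kappa>\<close> also take.\<close>

lemma gaussian_normalization:
  assumes S: "posdef N S" and Cov: "is_inverse N Cov S"
    and g [measurable]: "g \<in> borel_measurable (RN N)"
  shows "(\<integral>y. g y \<partial>centered_normal N Cov) =
     (\<integral>y. g y * exp (- (1/2) * qform N S y) \<partial>RN N) / (\<integral>y. exp (- (1/2) * qform N S y) \<partial>RN N)"
    and "(\<integral>y. exp (- (1/2) * qform N S y) \<partial>RN N) > 0"
proof -
  define I where "I = (2 * pi) powr (real N / 2) * mat_det N S powr (- 1/2)"
  have det: "mat_det N S > 0" using gaussian_integral(1)[OF S] .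
  have I: "(\<integral>y. exp (- (1/2) * qform N S y) \<partial>RN N) = I"
    by (rule integral_eq_nn_integral[THEN trans]) (simp_all add: gaussian_integral(2)[OF S, simplified] I_def)
  have I0: "I > 0" using det by (simp add: I_def)
  show "(\<integral>y. exp (- (1/2) * qform N S y) \<partial>RN N) > 0" using I I0 by simp
  have "mat_det N Cov = inverse (mat_det N S)"
    using is_inverse_mat_det[OF Cov] det by (simp add: field_simps)
  then have "mat_det N Cov powr (-1/2) = inverse (mat_det N S powr (- 1/2))"
    using det by (simp only: inverse_powr)
  moreover have "(2 * pi) powr (- real N / 2) = inverse ((2 * pi) powr (real N / 2))"
    using powr_minus[of "2 * pi" "real N / 2"] by simp
  ultimately have nf: "(2 * pi) powr (- real N / 2) * mat_det N Cov powr (-1/2) = 1 / I"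
    by (simp only: I_def inverse_eq_divide[symmetric] inverse_mult_distrib)
  have q: "(\<Sum>i<N. \<Sum>j<N. y i * mat_inv N Cov i j * y j) = qform N S y" for y
    unfolding qform_def by (intro sum.cong refl) (simp add: mat_inv_eq[OF Cov])
  have "(\<integral>y. g y \<partial>centered_normal N Cov) = (\<integral>y. (1 / I * exp (- (1/2) * qform N S y)) * g y \<partial>RN N)"
    unfolding centered_normal_def q nf using I0 by (intro integral_real_density) auto
  also have "\<dots> = (\<integral>y. 1 / I * (g y * exp (- (1/2) * qform N S y)) \<partial>RN N)"
    by (simp add: mult_ac)
  also have "\<dots> = 1 / I * (\<integral>y. g y * exp (- (1/2) * qform N S y) \<partial>RN N)"
    by (rule integral_mult_right_zero)
  finally show "(\<integral>y. g y \<partial>centered_normal N Cov) =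
     (\<integral>y. g y * exp (- (1/2) * qform N S y) \<partial>RN N) / (\<integral>y. exp (- (1/2) * qform N S y) \<partial>RN N)"
    unfolding I by simp
qed

text \<open>The point is that the prefactor does not depend on \<open>g\<close>, so the choice
  \<open>g = 1\<close> determines it.\<close>

lemma integral_rescaled:
  fixes g :: "(nat \<Rightarrow> real) \<Rightarrow> real"
  assumes \<kappa>: "\<kappa> > 0" and c: "c > 0" and X: "X \<in> measurable M (RN N)"
    and distr: "distr M (RN N) X = density (RN N) (\<lambda>x. ennreal (c * jacobi_weight N a b \<kappa> x))"
    and g [measurable]: "g \<in> borel_measurable (RN N)"
  shows "(\<integral>y. g y \<partial>distr M (RN N) (\<lambda>\<omega>. \<lambda>i\<in>{..<N}. sqrt \<kappa> * (X \<omega> i - z i)))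
    = (c * (1 / sqrt \<kappa>) ^ N * exp (\<kappa> * energy N a b z)) * (\<integral>y. g y * scaled_weight N a b z \<kappa> y \<partial>RN N)"
proof -
  define T where "T = affine_RN N (\<lambda>i. - sqrt \<kappa> * z i) (sqrt \<kappa>)"
  define A where "A = affine_RN N z (1 / sqrt \<kappa>)"
  have [measurable]: "T \<in> measurable (RN N) (RN N)" "A \<in> measurable (RN N) (RN N)"
    by (simp_all add: T_def A_def)
  have w0: "jacobi_weight N a b \<kappa> x \<ge> 0" if "x \<in> space (RN N)" for x
    using jacobi_weight_eq[OF that] by simp
  have TA: "T (A y) = y" if "y \<in> space (RN N)" for y
    using that \<kappa> by (auto simp: T_def A_def affine_RN_def space_RN PiE_iff extensional_def fun_eq_iff field_simps)
  have "(\<lambda>\<omega>. \<lambda>i\<in>{..<N}. sqrt \<kappa> * (X \<omega> i - z i)) = T \<circ> X"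
    by (auto simp: T_def affine_RN_def fun_eq_iff algebra_simps)
  then have "(\<integral>y. g y \<partial>distr M (RN N) (\<lambda>\<omega>. \<lambda>i\<in>{..<N}. sqrt \<kappa> * (X \<omega> i - z i)))
     = (\<integral>y. g y \<partial>distr (distr M (RN N) X) (RN N) T)"
    using X by (simp add: distr_distr)
  also have "\<dots> = (\<integral>x. g (T x) \<partial>density (RN N) (\<lambda>x. ennreal (c * jacobi_weight N a b \<kappa> x)))"
    unfolding distr by (rule integral_distr) auto
  also have "\<dots> = (\<integral>x. (c * jacobi_weight N a b \<kappa> x) * g (T x) \<partial>RN N)"
    using c w0 by (intro integral_real_density AE_I2) auto
  also have "\<dots> = (1 / sqrt \<kappa>) ^ N * (\<integral>y. (c * jacobi_weight N a b \<kappa> (A y)) * g (T (A y)) \<partial>RN N)"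
    unfolding A_def using \<kappa> by (intro integral_RN_affine) auto
  also have "(\<integral>y. (c * jacobi_weight N a b \<kappa> (A y)) * g (T (A y)) \<partial>RN N)
     = (\<integral>y. (c * exp (\<kappa> * energy N a b z)) * (g y * scaled_weight N a b z \<kappa> y) \<partial>RN N)"
    by (intro Bochner_Integration.integral_cong refl)
       (simp add: TA scaled_weight_def A_def[symmetric] exp_minus)
  also have "\<dots> = (c * exp (\<kappa> * energy N a b z)) * (\<integral>y. g y * scaled_weight N a b z \<kappa> y \<partial>RN N)"
    by (rule integral_mult_right_zero)
  finally show ?thesis by (simp only: mult_ac)
qed

theorem theorem2p6:
  fixes N :: nat and a b :: real
    and c :: "real \<Rightarrow> real"
    and M :: "real \<Rightarrow> 'w measure"
    and X :: "real \<Rightarrow> 'w \<Rightarrow> (nat \<Rightarrow> real)"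
    and z :: "nat \<Rightarrow> real"
  assumes a: "a \<ge> 0" and b: "b > 0"
    and c_pos: "\<And>\<kappa>. \<kappa> > 0 \<Longrightarrow> c \<kappa> > 0"
    and prob: "\<And>\<kappa>. \<kappa> > 0 \<Longrightarrow> prob_space (M \<kappa>)"
    and meas: "\<And>\<kappa>. \<kappa> > 0 \<Longrightarrow> X \<kappa> \<in> measurable (M \<kappa>) (RN N)"
    and distr: "\<And>\<kappa>. \<kappa> > 0 \<Longrightarrow>
       distr (M \<kappa>) (RN N) (X \<kappa>) = density (RN N) (\<lambda>x. ennreal (c \<kappa> * jacobi_weight N a b \<kappa> x))"
    and z_sorted: "\<And>i j. i \<le> j \<Longrightarrow> j < N \<Longrightarrow> z i \<le> z j"
    and z_zeros: "z ` {..<N} = {x. jacobiP N (a + b - 1) (b - 1) x = 0}"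
  shows "\<exists>Cov. is_inverse N Cov
           (\<lambda>i j. if i = j
                   then (\<Sum>l\<in>{..<N} - {j}. 1 / (z j - z l)\<^sup>2)
                        + (a + b) / 2 * (1 / (1 - z j)\<^sup>2) + b / 2 * (1 / (1 + z j)\<^sup>2)
                   else - 1 / (z i - z j)\<^sup>2)
         \<and> converges_in_distr N
             (\<lambda>\<kappa>. distr (M \<kappa>) (RN N) (\<lambda>\<omega>. \<lambda>i\<in>{..<N}. sqrt \<kappa> * (X \<kappa> \<omega> i - z i)))
             at_top (centered_normal N Cov)"
proof -
  have z: "open_simplex N z" and crit: "energy_deriv N a b z w = 0" for w
    using jacobiP_zeros_critical[of a b N z] a b z_sorted z_zeros by blast+
  define S where "S = hess N a b z"
  have S: "posdef N S" unfolding S_def by (rule posdef_hess[OF a b z])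
  obtain Cov where Cov: "is_inverse N Cov S"
    using is_inverse_exists[of N S] gaussian_integral(1)[OF S] by auto
  let ?\<mu> = "\<lambda>\<kappa>. distr (M \<kappa>) (RN N) (\<lambda>\<omega>. \<lambda>i\<in>{..<N}. sqrt \<kappa> * (X \<kappa> \<omega> i - z i))"
  let ?J = "\<lambda>g \<kappa>. \<integral>y. g y * scaled_weight N a b z \<kappa> y \<partial>RN N"
  let ?L = "\<lambda>g. \<integral>y. g y * exp (- (1/2) * qform N S y) \<partial>RN N"
  \<comment> \<open>The limiting value of the edge factor; being constant in \<open>y\<close>, it
    cancels in the quotient.\<close>
  define E where "E = exp (log_edge N z)"
  have J_lim: "(?J g \<longlongrightarrow> E * ?L g) at_top"
    if g: "g \<in> borel_measurable (RN N)" "\<And>y. y \<in> space (RN N) \<Longrightarrow> \<bar>g y\<bar> \<le> B" for g B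
  proof -
    have "(\<integral>y. g y * exp (- (1/2) * qform N S y + log_edge N z) \<partial>RN N)
        = (\<integral>y. E * (g y * exp (- (1/2) * qform N S y)) \<partial>RN N)"
      by (intro Bochner_Integration.integral_cong refl) (simp only: E_def exp_add mult_ac)
    also have "\<dots> = E * ?L g" by (rule integral_mult_right_zero)
    finally show ?thesis
      using integral_scaled_weight_tendsto[OF a b z crit g] by (simp add: S_def)
  qed
  have "converges_in_distr N ?\<mu> at_top (centered_normal N Cov)"
    unfolding converges_in_distr_def
  proof (intro allI impI, elim conjE)
    fix g :: "(nat \<Rightarrow> real) \<Rightarrow> real"
    assume "continuous_on (PiE {..<N} (\<lambda>_. UNIV)) g" and bd: "bounded (g ` PiE {..<N} (\<lambda>_. UNIV))"
    then have g [measurable]: "g \<in> borel_measurable (RN N)" by (intro borel_measurable_RN_continuous_on)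
    obtain B where B: "\<And>y. y \<in> space (RN N) \<Longrightarrow> \<bar>g y\<bar> \<le> B"
      using bd unfolding bounded_iff space_RN by auto
    \<comment> \<open>The rescaled law has total mass one, so \<open>integral_rescaled\<close> for
      the constant \<open>1\<close> identifies the prefactor, including \<open>c \<kappa>\<close>,
      as the reciprocal of \<open>?J (\<lambda>_. 1) \<kappa>\<close>.\<close>
    have eq: "(\<integral>y. g y \<partial>?\<mu> \<kappa>) = ?J g \<kappa> / ?J (\<lambda>_. 1) \<kappa>" if \<kappa>: "\<kappa> > 0" for \<kappa>
    proof -
      note R = integral_rescaled[OF \<kappa> c_pos[OF \<kappa>] meas[OF \<kappa>] distr[OF \<kappa>], of _ z]
      have "(\<lambda>\<omega>. \<lambda>i\<in>{..<N}. sqrt \<kappa> * (X \<kappa> \<omega> i - z i)) \<in> measurable (M \<kappa>) (PiM {..<N} (\<lambda>_. lborel))"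
        using measurable_compose[OF meas[OF \<kappa>] measurable_RN_component]
        by (intro measurable_restrict) auto
      then have "prob_space (?\<mu> \<kappa>)"
        using prob[OF \<kappa>] by (intro prob_space.prob_space_distr) (simp_all add: RN_def)
      then have "(\<integral>y. 1 \<partial>?\<mu> \<kappa>) = (1::real)" using prob_space.prob_space[of "?\<mu> \<kappa>"] by simp
      then have 1: "(c \<kappa> * (1 / sqrt \<kappa>) ^ N * exp (\<kappa> * energy N a b z)) * ?J (\<lambda>_. 1) \<kappa> = 1"
        using R[of "\<lambda>_. 1"] by simp
      then have "?J (\<lambda>_. 1) \<kappa> \<noteq> 0" by auto
      then have "c \<kappa> * (1 / sqrt \<kappa>) ^ N * exp (\<kappa> * energy N a b z) = 1 / ?J (\<lambda>_. 1) \<kappa>"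
        by (rule iffD2[OF nonzero_eq_divide_eq]) (rule 1)
      then show ?thesis unfolding R[OF g] by simp
    qed
    have L0: "?L (\<lambda>_. 1) > 0" using gaussian_normalization(2)[OF S Cov g] by simp
    have "((\<lambda>\<kappa>. ?J g \<kappa> / ?J (\<lambda>_. 1) \<kappa>) \<longlongrightarrow> (E * ?L g) / (E * ?L (\<lambda>_. 1))) at_top"
      using L0 by (intro tendsto_divide J_lim[OF g B] J_lim[where B = 1]) (auto simp: E_def)
    also have "(E * ?L g) / (E * ?L (\<lambda>_. 1)) = (\<integral>y. g y \<partial>centered_normal N Cov)"
      using gaussian_normalization(1)[OF S Cov g] by (simp add: E_def)
    finally show "((\<lambda>\<kappa>. \<integral>y. g y \<partial>?\<mu> \<kappa>) \<longlongrightarrow> (\<integral>y. g y \<partial>centered_normal N Cov)) at_top"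
      by (rule Lim_transform_eventually)
         (use eventually_gt_at_top[of "0::real"] in \<open>eventually_elim, simp add: eq\<close>)
  qed
  with Cov show ?thesis unfolding S_def hess_def by blast
qed

end
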